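(* Let $n\ge1$ and index both matrices below by $\pi\in NC^B(n)$, where the Gram-matrix row/column of $\pi$ is the one of $\beta_B(\pi)\in NCM^B(n)$. Then, as an identity of matrices whose entries are functions of $\delta>0$, $$J^B_n(\delta^2)=P^B\,G^B_n(1,\delta)\,P^B,$$ where $P^B$ is diagonal with entry $\delta^{\mathrm{nzbk}(\pi)-n/2}$ in the row of $\pi$. Equivalently, for all $\pi,\pi'\in NC^B(n)$, $$2\,\mathrm{nzbk}(\pi\vee\pi')=c_d\big(\beta_B(\pi)\vee\beta_B(\pi')\big)+\mathrm{nzbk}(\pi)+\mathrm{nzbk}(\pi')-n.$$
   Context: A type $B$ $n$-partition is a partition $\pi$ of $\{+1,\dots,+n,-1,\dots,-n\}$ such that $-K$ is a block whenever $K$ is, with at most one block $K$ satisfying $K=-K$ (a zero, or invariant, block). $\mathrm{bk}_0(\pi)$ is the number of zero blocks and $\mathrm{nzbk}(\pi)$ is half the number of non-zero blocks. Place $+1,\dots,+n,-1,\dots,-n$ anticlockwise at equally spaced points on the boundary circle of a disk, so that $i\mapsto -i$ is the rotation by $\pi$. Using the order $+1<\dots<+n<-1<\dots<-n$, draw a connection chord between $i<j$ when they are in the same block with no element of that block strictly between them; $\pi$ is non-crossing if these chords can be drawn without crossing. $NC^B(n)$ is the set of non-crossing type $B$ $n$-partitions. For $\pi,\pi'\in NC^B(n)$, $\pi\vee\pi'$ is the finest partition of $\{\pm1,\dots,\pm n\}$ coarser than both (it is closed under negation, need not be non-crossing, and may have up to two zero blocks); $\mathrm{bk}_0$ and $\mathrm{nzbk}$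 are defined for it in the same way. The type $B$ matrix of chromatic joins $J^B_n(\delta)$ has $(\pi,\pi')$ entry $\delta^{\mathrm{nzbk}(\pi\vee\pi')}$. $NCM^B(n)$ is the set of non-crossing perfect matchings of $4n$ equally spaced points on a circle that are invariant under rotation by $\pi$. The bijection $\beta_B:NC^B(n)\to NCM^B(n)$: the frontier in the disk of a regular neighborhood of the union of the $2n$ points and the connection chords of $\pi$ consists of $2n$ arcs with $4n$ endpoints on the circle (two near each labeled point), forming $\beta_B(\pi)$. For $b,b'\in NCM^B(n)$, $b\vee b'$ is the family of disjoint circles on the 2-sphere obtained by drawing $b$ in one disk and $b'$ in the complementary disk, glued along the boundary respecting labels; the rotation by $\pi$ of each disk extends to an involution of the sphere fixing the two disk centers. $c_0(b\vee b')$ is the number of circles $C$ with $C=-C$ (zero circles), and $c_d(b\vee b')$ is the number of pairs $\{C,-C\}$ of circles with $C\neq -C$. The type $B$ Temperley–Lieb Gram matrix $G^B_n(\alpha,\delta)$ has $(b,b')$ entry $\alpha^{c_0(b\vee b')}\delta^{c_d(b\vee b')}$. *)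

theory Defs
  imports "HOL-Analysis.Analysis" "HOL-Library.Disjoint_Sets"
begin

text \<open>Points +1,...,+n,-1,...,-n are encoded as positions 0,...,2n-1 (in this order,
  anticlockwise on the circle): +k is k-1, -k is n+k-1.  Negation (rotation by pi)
  is x |-> (x + n) mod 2n.\<close>

definition negB :: "nat \<Rightarrow> nat \<Rightarrow> nat" where
  "negB n x = (x + n) mod (2 * n)"

definition negsetB :: "nat \<Rightarrow> nat set \<Rightarrow> nat set" where
  "negsetB n K = negB n ` K"

definition typeB_partition :: "nat \<Rightarrow> nat set set \<Rightarrow> bool" where
  "typeB_partition n P \<longleftrightarrow> partition_on {0..<2*n} P \<and> (\<forall>K\<in>P. negsetB n K \<in> P)
     \<and> card {K\<in>P. negsetB n K = K} \<le> 1"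

text \<open>Connection chords: i<j in the same block with no element of the block strictly between.\<close>
definition chords :: "nat set set \<Rightarrow> (nat \<times> nat) set" where
  "chords P = {(i,j). \<exists>K\<in>P. i \<in> K \<and> j \<in> K \<and> i < j \<and> \<not> (\<exists>k\<in>K. i < k \<and> k < j)}"

text \<open>Two chords with endpoints on the circle cross iff their endpoints interleave.\<close>
definition noncrossing :: "nat set set \<Rightarrow> bool" where
  "noncrossing P \<longleftrightarrow> (\<forall>(i,j)\<in>chords P. \<forall>(k,l)\<in>chords P. \<not> (i < k \<and> k < j \<and> j < l))"

definition NCB :: "nat \<Rightarrow> nat set set set" where
  "NCB n = {P. typeB_partition n P \<and> noncrossing P}"

text \<open>Join: finest partition coarser than both = classes of the equivalence closure.\<close>
definition joinB :: "nat \<Rightarrow> nat set set \<Rightarrow> nat set set \<Rightarrow> nat set set" where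
  "joinB n P Q = {0..<2*n} // ({(x,y). \<exists>K\<in>P \<union> Q. x \<in> K \<and> y \<in> K}\<^sup>+)"

definition bk0 :: "nat \<Rightarrow> nat set set \<Rightarrow> nat" where
  "bk0 n P = card {K\<in>P. negsetB n K = K}"

definition nzbk :: "nat \<Rightarrow> nat set set \<Rightarrow> nat" where
  "nzbk n P = card {K\<in>P. negsetB n K \<noteq> K} div 2"

text \<open>Matchings on 4n points 0..4n-1; the labelled point at position p has the two
  nearby points 2p (just before it) and 2p+1 (just after it).  Rotation by pi is
  x |-> (x + 2n) mod 4n.\<close>

definition rotM :: "nat \<Rightarrow> nat \<Rightarrow> nat" where
  "rotM n x = (x + 2 * n) mod (4 * n)"

definition NCMB :: "nat \<Rightarrow> nat set set set" where
  "NCMB n = {M. partition_on {0..<4*n} M \<and> (\<forall>e\<in>M. card e = 2)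
     \<and> (\<forall>e\<in>M. rotM n ` e \<in> M)
     \<and> (\<forall>a b c d. {a,c} \<in> M \<longrightarrow> {b,d} \<in> M \<longrightarrow> \<not> (a < b \<and> b < c \<and> c < d))}"

text \<open>Cyclic successor of a in block K.\<close>
definition cyc_succ :: "nat set \<Rightarrow> nat \<Rightarrow> nat" where
  "cyc_succ K a = (if \<exists>k\<in>K. a < k then Min {k\<in>K. a < k} else Min K)"

text \<open>beta_B: the frontier of a regular neighbourhood of the points and chords of a
  non-crossing partition: around each block, an arc joins the point just after a to the
  point just before the cyclic successor of a in its block.\<close>
definition betaB :: "nat set set \<Rightarrow> nat set set" where
  "betaB P = {{2*a+1, 2 * cyc_succ K a} | K a. K \<in> P \<and> a \<in> K}"

text \<open>Circles of b \<or> b': connected components of the union of the two matchings.\<close>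
definition circles :: "nat \<Rightarrow> nat set set \<Rightarrow> nat set set \<Rightarrow> nat set set" where
  "circles n M M' = {0..<4*n} // ({(x,y). {x,y} \<in> M \<union> M'}\<^sup>*)"

definition c0 :: "nat \<Rightarrow> nat set set \<Rightarrow> nat set set \<Rightarrow> nat" where
  "c0 n M M' = card {C\<in>circles n M M'. rotM n ` C = C}"

definition cd :: "nat \<Rightarrow> nat set set \<Rightarrow> nat set set \<Rightarrow> nat" where
  "cd n M M' = card {C\<in>circles n M M'. rotM n ` C \<noteq> C} div 2"

text \<open>Matrix entries.\<close>
definition JB_entry :: "nat \<Rightarrow> real \<Rightarrow> nat set set \<Rightarrow> nat set set \<Rightarrow> real" where
  "JB_entry n \<delta> P Q = \<delta> ^ nzbk n (joinB n P Q)"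

definition GB_entry :: "nat \<Rightarrow> real \<Rightarrow> real \<Rightarrow> nat set set \<Rightarrow> nat set set \<Rightarrow> real" where
  "GB_entry n \<alpha> \<delta> M M' = \<alpha> ^ c0 n M M' * \<delta> ^ cd n M M'"

definition PB_entry :: "nat \<Rightarrow> real \<Rightarrow> nat set set \<Rightarrow> real" where
  "PB_entry n \<delta> P = \<delta> powr (real (nzbk n P) - real n / 2)"

end

theory Submission
  imports Defs
begin

text \<open>
  For non-crossing partitions of \<open>N\<close> points on a circle, drawn inside and outside of it, Euler's formula on
  the sphere gives \<open>circles + blocks + blocks' = N + 2 * joined blocks\<close>. It is proved by deleting a point:
  an innermost chord argument shows that one of the two partitions has a singleton block or two cyclically
  adjacent points in a common block, and in the second case the two points are contracted to one.

  Dividing by the rotation by \<open>\<pi>\<close> turns a type B partition of \<open>2n\<close> points into a non-crossing partition of \<open>n\<close>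
  points on the quotient sphere, so the formula holds for the quotient as well. Passing to the quotient
  halves the number of non-zero blocks and circles and keeps the zero ones. The difference of the formulas
  for \<open>2n\<close> and \<open>n\<close> points is therefore the claim, with all zero blocks and zero circles cancelled.
\<close>

section \<open>Connected components of relations\<close>

text \<open>The formula is an Euler characteristic. Thicken every block of the inner and of the
  outer partition to a disc and glue the discs at the \<open>N\<close> points: the surface has
  characteristic \<open>blocks + blocks' - N\<close>. It lies in the sphere, so a component with
  \<open>b\<close> boundary circles has characteristic \<open>2 - b\<close>; summed over the joined
  blocks this gives \<open>2 * joined - circles\<close>. Deleting a single point destroys the
  symmetry under negation, so the induction leaves type B: it treats non-crossing labellings of an
  arbitrary finite set of naturals, blocks being level sets. That form also covers the quotient,
  since a disc divided by the half turn is again a disc. What has to be checked there is that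
  quotient labels do not cross and that cyclic successors, hence the arcs of \<open>betaB\<close>,
  descend modulo \<open>n\<close>. All circles and joins are components of relations, so most steps
  compare components under a map with connected fibres.\<close>

definition conn :: "('a \<times> 'a) set \<Rightarrow> ('a \<times> 'a) set" where
  "conn E = (E \<union> E\<inverse>)\<^sup>*"

text \<open>Classes are formed in the whole type, where a point without edges is a class by itself;
  hence the restriction to classes of points of \<open>S\<close>.\<close>

definition ncomp :: "'a set \<Rightarrow> ('a \<times> 'a) set \<Rightarrow> nat" where
  "ncomp S E = card ((\<lambda>x. conn E `` {x}) ` S)"

lemma conn_refl [simp]: "(x, x) \<in> conn E"
  by (simp add: conn_def)

lemma conn_sym: "(x, y) \<in> conn E \<Longrightarrow> (y, x) \<in> conn E"
  unfolding conn_def by (metis converse_Un converse_converse rtrancl_converseI sup_commute)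

lemma conn_trans: "(x, y) \<in> conn E \<Longrightarrow> (y, z) \<in> conn E \<Longrightarrow> (x, z) \<in> conn E"
  unfolding conn_def by (rule rtrancl_trans)

lemma conn_edge: "(x, y) \<in> E \<Longrightarrow> (x, y) \<in> conn E"
  unfolding conn_def by blast

lemma conn_class_eq: "conn E `` {x} = conn E `` {y} \<longleftrightarrow> (x, y) \<in> conn E"
  by (auto intro: conn_trans conn_sym)

lemma conn_map:
  assumes "(x, y) \<in> conn E" "\<And>u v. (u, v) \<in> E \<Longrightarrow> (h u, h v) \<in> conn E'"
  shows "(h x, h y) \<in> conn E'"
  using assms(1) unfolding conn_def[of E]
proof (induction rule: rtrancl_induct)
  case (step y z)
  then have "(h y, h z) \<in> conn E'"
    using assms(2) conn_sym by fastforce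
  with step.IH show ?case
    by (rule conn_trans)
qed simp

lemma conn_mono: "E \<subseteq> E' \<Longrightarrow> (x, y) \<in> conn E \<Longrightarrow> (x, y) \<in> conn E'"
  using conn_map[of x y E id E'] by (auto intro: conn_edge)

lemma conn_closed:
  assumes "(x, y) \<in> conn E" "x \<in> S" "E \<subseteq> S \<times> S"
  shows "y \<in> S"
  using assms(1) unfolding conn_def
  by (induction rule: rtrancl_induct) (use assms(2,3) in auto)

text \<open>Both cardinalities count the classes of the same kernel on \<open>S\<close>.\<close>

lemma card_image_eq_kernel:
  assumes "\<And>x y. x \<in> S \<Longrightarrow> y \<in> S \<Longrightarrow> f x = f y \<longleftrightarrow> g x = g y"
  shows "card (f ` S) = card (g ` S)"
proof -
  have eq: "g (inv_into S f (f x)) = g x" if "x \<in> S" for x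
    using assms[of "inv_into S f (f x)" x] that by (simp add: f_inv_into_f inv_into_into)
  have "bij_betw (\<lambda>u. g (inv_into S f u)) (f ` S) (g ` S)"
    unfolding bij_betw_def
  proof
    show "inj_on (\<lambda>u. g (inv_into S f u)) (f ` S)"
      using assms eq by (auto intro!: inj_onI)
    show "(\<lambda>u. g (inv_into S f u)) ` f ` S = g ` S"
      using eq by (auto simp: image_image)
  qed
  then show ?thesis
    by (rule bij_betw_same_card)
qed

lemma ncomp_label:
  assumes "\<And>x y. x \<in> S \<Longrightarrow> y \<in> S \<Longrightarrow> l x = l y \<longleftrightarrow> (x, y) \<in> conn E"
  shows "ncomp S E = card (l ` S)"
  unfolding ncomp_def using assms by (intro card_image_eq_kernel) (simp add: conn_class_eq)

text \<open>Contracting connected fibres preserves components. An edge downstairs only has to lift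
  to some connected pair; \<open>fib\<close> moves the ends of the lift to any other preimages. This
  serves for contracting a point, for replacing matching points by positions, and for reducing
  modulo \<open>n\<close>.\<close>

lemma ncomp_quotient:
  assumes surj: "h ` S = S'" and sub: "E' \<subseteq> S' \<times> S'"
    and fwd: "\<And>x y. (x, y) \<in> E \<Longrightarrow> (h x, h y) \<in> conn E'"
    and bwd: "\<And>u v. (u, v) \<in> E' \<Longrightarrow> \<exists>x\<in>S. \<exists>y\<in>S. h x = u \<and> h y = v \<and> (x, y) \<in> conn E"
    and fib: "\<And>x y. x \<in> S \<Longrightarrow> y \<in> S \<Longrightarrow> h x = h y \<Longrightarrow> (x, y) \<in> conn E"
  shows "ncomp S E = ncomp S' E'"
proof -
  \<comment> \<open>Quantifying over all preimages lets the induction switch from one lift of the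
    middle vertex \<open>v\<close> to another.\<close>
  have lift: "\<forall>x\<in>S. \<forall>y\<in>S. h x = u \<longrightarrow> h y = v \<longrightarrow> (x, y) \<in> conn E" if "(u, v) \<in> conn E'" for u v
    using that unfolding conn_def[of E']
  proof (induction rule: rtrancl_induct)
    case base
    then show ?case using fib by simp
  next
    case (step v w)
    have "\<exists>x\<in>S. \<exists>y\<in>S. h x = v \<and> h y = w \<and> (x, y) \<in> conn E"
      using step.hyps(2) bwd conn_sym by (metis UnE converseD)
    then obtain p q where pq: "p \<in> S" "q \<in> S" "h p = v" "h q = w" "(p, q) \<in> conn E"
      by blast
    show ?case
      using step.IH pq fib by (metis conn_trans)
  qed
  have "ncomp S E = card ((\<lambda>x. conn E' `` {h x}) ` S)"
    by (rule ncomp_label) (use lift conn_map fwd in \<open>metis conn_class_eq\<close>)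
  also have "\<dots> = ncomp S' E'"
    unfolding ncomp_def by (simp add: surj[symmetric] image_image)
  finally show ?thesis .
qed

lemma ncomp_contract:
  fixes c t :: "'a" and h
  defines "h \<equiv> \<lambda>y. if y = c then t else y"
  assumes "c \<notin> S" "t \<in> S" "X \<subseteq> insert c S \<times> insert c S"
  shows "ncomp (insert c S) (insert (c, t) X) = ncomp S (map_prod h h ` X)"
proof (rule ncomp_quotient[where h = h])
  have ct: "(c, t) \<in> conn (insert (c, t) X)"
    by (simp add: conn_edge)
  have hx: "(x, h x) \<in> conn (insert (c, t) X)" for x
    using ct by (simp add: h_def)
  show "h ` insert c S = S"
    using assms(2,3) by (auto simp: h_def image_iff)
  show "map_prod h h ` X \<subseteq> S \<times> S"
    using assms(2-4) by (auto simp: h_def)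
  show "(h x, h y) \<in> conn (map_prod h h ` X)" if "(x, y) \<in> insert (c, t) X" for x y
  proof (cases "(x, y) \<in> X")
    case True
    then have "(h x, h y) \<in> map_prod h h ` X"
      by (rule rev_image_eqI) simp
    then show ?thesis by (rule conn_edge)
  next
    case False
    then show ?thesis using that by (auto simp: h_def)
  qed
  show "\<exists>x\<in>insert c S. \<exists>y\<in>insert c S. h x = u \<and> h y = v \<and> (x, y) \<in> conn (insert (c, t) X)"
    if uv: "(u, v) \<in> map_prod h h ` X" for u v
    using uv
  proof (rule imageE)
    fix p
    assume "(u, v) = map_prod h h p" "p \<in> X"
    then have "h (fst p) = u" "h (snd p) = v" "(fst p, snd p) \<in> X"
      by (simp_all add: map_prod_def split_beta)
    moreover have "p \<in> insert c S \<times> insert c S"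
      using assms(4) \<open>p \<in> X\<close> by (rule subsetD)
    ultimately show ?thesis
      using conn_edge[of "fst p" "snd p" "insert (c, t) X"] by (metis insertCI mem_Times_iff)
  qed
  show "(x, y) \<in> conn (insert (c, t) X)" if "h x = h y" for x y
    using hx[of x] hx[of y] that by (metis conn_sym conn_trans)
qed

text \<open>The loop at \<open>b\<close> matches \<open>circ_rel\<close> and
  \<open>join_rel\<close>, which contain it at a point that splits off.\<close>

lemma ncomp_isolated:
  assumes "finite S" "b \<notin> S" "E \<subseteq> S \<times> S"
  shows "ncomp (insert b S) (insert (b, b) E) = Suc (ncomp S E)"
proof -
  have conn_eq: "(x, y) \<in> conn (insert (b, b) E) \<longleftrightarrow> (x, y) \<in> conn E" for x y
  proof
    assume "(x, y) \<in> conn (insert (b, b) E)"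
    then have "(id x, id y) \<in> conn E"
      by (rule conn_map) (auto intro: conn_edge)
    then show "(x, y) \<in> conn E" by simp
  qed (auto intro: conn_mono[rotated])
  have "ncomp (insert b S) (insert (b, b) E) = card ((\<lambda>x. conn E `` {x}) ` insert b S)"
    by (rule ncomp_label) (simp add: conn_class_eq conn_eq)
  also have "conn E `` {b} \<notin> (\<lambda>x. conn E `` {x}) ` S"
    using conn_closed[OF _ _ assms(3)] assms(2) by (metis (no_types, lifting) conn_class_eq conn_sym imageE)
  then have "card ((\<lambda>x. conn E `` {x}) ` insert b S) = Suc (ncomp S E)"
    using assms(1) by (simp add: ncomp_def)
  finally show ?thesis .
qed

section \<open>Non-crossing labellings and cyclic successors\<close>

text \<open>\<open>z\<close> lies strictly inside the anticlockwise arc from \<open>x\<close> to \<open>y\<close>; for \<open>x = y\<close> that arc is the full turn.\<close>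
definition cbetw :: "nat \<Rightarrow> nat \<Rightarrow> nat \<Rightarrow> bool" where
  "cbetw x z y \<longleftrightarrow> (if x < y then x < z \<and> z < y else x < z \<or> z < y)"

text \<open>Blocks are level sets of a labelling: deleting a point only shrinks \<open>S\<close>,
  merging blocks only changes labels.\<close>

definition bnext :: "nat set \<Rightarrow> (nat \<Rightarrow> 'a) \<Rightarrow> nat \<Rightarrow> nat" where
  "bnext S f x = cyc_succ {y \<in> S. f y = f x} x"

text \<open>Replaces the wrap-around and \<open>Min\<close> of \<open>cyc_succ\<close> by one cyclic
  condition, an arc free of block elements. For a singleton block \<open>y = x\<close>, and the arc
  is the full turn.\<close>

lemma bnext_iff:
  assumes "finite S" "x \<in> S"
  shows "bnext S f x = y \<longleftrightarrow> y \<in> S \<and> f y = f x \<and> (\<forall>z\<in>S. f z = f x \<longrightarrow> \<not> cbetw x z y)"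
proof -
  let ?K = "{y \<in> S. f y = f x}"
  have spec: "bnext S f x \<in> ?K \<and> (\<forall>z\<in>?K. \<not> cbetw x z (bnext S f x))"
  proof (cases "\<exists>k\<in>?K. x < k")
    case True
    let ?L = "{k \<in> ?K. x < k}"
    have L: "finite ?L" "?L \<noteq> {}"
      using assms True by auto
    have eq: "bnext S f x = Min ?L"
      using True by (simp add: bnext_def cyc_succ_def)
    show ?thesis
      using Min_in[OF L] Min_le[OF L(1)] unfolding eq[symmetric] by (force simp: cbetw_def)
  next
    case False
    have K: "finite ?K" "?K \<noteq> {}"
      using assms by auto
    have eq: "bnext S f x = Min ?K"
      using False by (simp add: bnext_def cyc_succ_def)
    show ?thesis
      using Min_in[OF K] Min_le[OF K(1)] assms False unfolding eq[symmetric] by (force simp: cbetw_def)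
  qed
  \<comment> \<open>Uniqueness: of two different candidates, one lies on the way from
    \<open>x\<close> to the other.\<close>
  have "y = y'" if "\<not> cbetw x y y'" "\<not> cbetw x y' y" for y y'
    using that by (auto simp: cbetw_def split: if_splits)
  then show ?thesis
    using spec by blast
qed

lemma bnext_props:
  assumes "finite S" "x \<in> S"
  shows "bnext S f x \<in> S" "f (bnext S f x) = f x"
    "\<And>z. z \<in> S \<Longrightarrow> f z = f x \<Longrightarrow> \<not> cbetw x z (bnext S f x)"
  using bnext_iff[OF assms, of f "bnext S f x"] by auto

text \<open>Walking back from the common successor, the point met first would lie on the arc that
  starts at the other one.\<close>

lemma bnext_inj:
  assumes "finite S" "x \<in> S" "x' \<in> S" "bnext S f x = bnext S f x'"
  shows "x = x'"
proof -
  have "\<not> cbetw x x' (bnext S f x)" "\<not> cbetw x' x (bnext S f x)"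
    using assms bnext_props by metis+
  then show ?thesis
    by (auto simp: cbetw_def split: if_splits)
qed

lemma bnext_delete:
  assumes "finite S" "a \<in> S" "x \<in> S - {a}"
  shows "bnext (S - {a}) f x = (if bnext S f x = a then bnext S f a else bnext S f x)"
proof (cases "bnext S f x = a")
  case False
  then show ?thesis
    using assms bnext_props[of S x, where f = f] by (subst bnext_iff) auto
next
  case True
  have x: "x \<in> S" "x \<noteq> a" and fx: "f a = f x"
    using assms bnext_props(2)[of S x f] True by auto
  have na: "bnext S f a \<noteq> a"
    using bnext_inj[OF assms(1,2) x(1)] True x by metis
  have "\<not> cbetw x z (bnext S f a)" if "z \<in> S" "z \<noteq> a" "f z = f x" for z
  proof -
    \<comment> \<open>The arc from \<open>x\<close> through \<open>a\<close> to the successor of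
      \<open>a\<close> consists of two empty arcs; the third fact says that it does not run past
      \<open>x\<close>.\<close>
    have "\<not> cbetw x z a" "\<not> cbetw a z (bnext S f a)" "\<not> cbetw a x (bnext S f a)"
      using bnext_props(3)[OF assms(1), where f = f] x that fx True assms(2) by metis+
    then show ?thesis
      using x(2) that(2) na by (auto simp: cbetw_def split: if_splits)
  qed
  then show ?thesis
    using True na fx assms bnext_props[OF assms(1,2), where f = f] by (subst bnext_iff) auto
qed

text \<open>No chord of one block separates two points of another. Written with
  \<open>cbetw\<close>, the condition has no distinguished starting point on the circle; exchanging
  \<open>u\<close> and \<open>v\<close> turns the implication into the equivalence
  \<open>noncrossD\<close>.\<close>

definition noncross :: "nat set \<Rightarrow> (nat \<Rightarrow> 'a) \<Rightarrow> bool" where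
  "noncross S f \<longleftrightarrow> (\<forall>w\<in>S. \<forall>z\<in>S. \<forall>u\<in>S. \<forall>v\<in>S.
     f w = f z \<longrightarrow> f u = f v \<longrightarrow> f w \<noteq> f u \<longrightarrow> cbetw w u z \<longrightarrow> cbetw w v z)"

lemma noncrossD:
  assumes "noncross S f" "w \<in> S" "z \<in> S" "u \<in> S" "v \<in> S" "f w = f z" "f u = f v" "f w \<noteq> f u"
  shows "cbetw w u z \<longleftrightarrow> cbetw w v z"
  using assms unfolding noncross_def by metis

lemma noncross_subset: "noncross S f \<Longrightarrow> S' \<subseteq> S \<Longrightarrow> noncross S' f"
  unfolding noncross_def by blast

lemma noncrossI:
  assumes "\<And>a b c d. a \<in> S \<Longrightarrow> b \<in> S \<Longrightarrow> c \<in> S \<Longrightarrow> d \<in> S \<Longrightarrow> a < b \<Longrightarrow> b < c \<Longrightarrow> c < d \<Longrightarrow>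
     f a = f c \<Longrightarrow> f b = f d \<Longrightarrow> f a = f b"
  shows "noncross S f"
  unfolding noncross_def
proof (intro ballI impI)
  fix w z u v
  assume S: "w \<in> S" "z \<in> S" "u \<in> S" "v \<in> S"
    and eq: "f w = f z" "f u = f v" "f w \<noteq> f u" and "cbetw w u z"
  have ne: "v \<noteq> w" "v \<noteq> z"
    using eq by auto
  show "cbetw w v z"
  proof (rule ccontr)
    assume "\<not> cbetw w v z"
    \<comment> \<open>One cyclic pattern \<open>w, u, z, v\<close>, cut open by the linear order at
      four different places.\<close>
    then consider "w < u" "u < z" "z < v" | "v < w" "w < u" "u < z"
      | "z < v" "v < w" "w < u" | "u < z" "z < v" "v < w"
      using \<open>cbetw w u z\<close> ne by (auto simp: cbetw_def split: if_splits)
    then show False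
    proof cases
      case 1 then show ?thesis using assms[of w u z v] S eq by simp
    next
      case 2 then show ?thesis using assms[of v w u z] S eq by simp
    next
      case 3 then show ?thesis using assms[of z v w u] S eq by simp
    next
      case 4 then show ?thesis using assms[of u z v w] S eq by simp
    qed
  qed
qed

section \<open>Merging the blocks of two adjacent points\<close>

definition merge :: "(nat \<Rightarrow> 'a) \<Rightarrow> nat \<Rightarrow> nat \<Rightarrow> nat \<Rightarrow> 'a" where
  "merge g a b = (\<lambda>z. if g z = g b then g a else g z)"

definition adjacent :: "nat set \<Rightarrow> nat \<Rightarrow> nat \<Rightarrow> bool" where
  "adjacent S a b \<longleftrightarrow> a \<in> S \<and> b \<in> S \<and> a < b \<and> (\<forall>z\<in>S. \<not> (a < z \<and> z < b))"

lemma adjacent_cbetw: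
  assumes "adjacent S a b" "w \<in> S" "z \<in> S" "w \<noteq> a" "w \<noteq> b" "z \<noteq> a" "z \<noteq> b"
  shows "cbetw w a z \<longleftrightarrow> cbetw w b z"
proof -
  have "w \<le> a \<or> b \<le> w" "z \<le> a \<or> b \<le> z" "a < b"
    using assms unfolding adjacent_def by force+
  then show ?thesis
    using assms(4-7) by (auto simp: cbetw_def)
qed

text \<open>Without singleton blocks, take two points of one block at least distance. A point
  between them has another label by minimality, and a partner that non-crossing keeps between them
  too: a closer pair.\<close>

lemma noncross_reducible:
  assumes "finite S" "S \<noteq> {}" "noncross S f"
  obtains a where "a \<in> S" "\<And>x. x \<in> S \<Longrightarrow> f x = f a \<Longrightarrow> x = a"
  | a b where "adjacent S a b" "f a = f b"
proof (cases "\<exists>a\<in>S. \<forall>x\<in>S. f x = f a \<longrightarrow> x = a")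
  case True
  then show ?thesis using that(1) by blast
next
  case False
  define pairs where "pairs = {(a, b). a \<in> S \<and> b \<in> S \<and> a < b \<and> f a = f b}"
  have pair: "\<exists>y\<in>S. y \<noteq> x \<and> f y = f x" if "x \<in> S" for x
    using False that by blast
  obtain x where "x \<in> S"
    using assms(2) by blast
  with pair[of x] obtain y where "y \<in> S" "y \<noteq> x" "f y = f x"
    by blast
  then have "(min x y, max x y) \<in> pairs"
    using \<open>x \<in> S\<close> by (auto simp: pairs_def min_def max_def)
  from ex_has_least_nat[of "\<lambda>p. p \<in> pairs", OF this, of "\<lambda>p. snd p - fst p"]
  obtain a b where ab: "(a, b) \<in> pairs" and min: "\<And>c d. (c, d) \<in> pairs \<Longrightarrow> b - a \<le> d - c"
    by fastforce
  have "\<not> (a < z \<and> z < b)" if z: "z \<in> S" for z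
  proof
    assume azb: "a < z \<and> z < b"
    have "f z \<noteq> f a"
      using min[of a z] azb ab z by (auto simp: pairs_def)
    obtain z' where z': "z' \<in> S" "z' \<noteq> z" "f z' = f z"
      using pair z by blast
    have "cbetw a z b"
      using azb by (simp add: cbetw_def)
    then have "cbetw a z' b"
      using noncrossD[OF assms(3), of a b z z'] ab z z' \<open>f z \<noteq> f a\<close> by (auto simp: pairs_def)
    then have "a < z'" "z' < b"
      using azb by (auto simp: cbetw_def)
    then show False
      using min[of z z'] min[of z' z] azb z z' by (cases "z < z'") (auto simp: pairs_def)
  qed
  then show ?thesis
    using ab that(2)[of a b] by (auto simp: pairs_def adjacent_def)
qed

lemma bnext_adjacent:
  assumes "finite S" "adjacent S a b" "f a = f b"
  shows "bnext S f a = b"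
  using assms by (subst bnext_iff) (auto simp: adjacent_def cbetw_def)

text \<open>A chord of a third block has no end at \<open>a\<close> or \<open>b\<close>, so these
  neighbours lie on the same side of it, and with them their whole blocks.\<close>

lemma noncross_merge:
  assumes "noncross S g" "adjacent S a b" "g a \<noteq> g b"
  shows "noncross S (merge g a b)"
  unfolding noncross_def
proof (intro ballI impI)
  fix w z u v
  assume S: "w \<in> S" "z \<in> S" "u \<in> S" "v \<in> S"
    and eq: "merge g a b w = merge g a b z" "merge g a b u = merge g a b v" "merge g a b w \<noteq> merge g a b u"
    and uz: "cbetw w u z"
  have ab: "a \<in> S" "b \<in> S"
    using assms(2) by (auto simp: adjacent_def)
  have side: "cbetw w u z \<longleftrightarrow> cbetw w v z" 
    if wz: "w \<in> S" "z \<in> S" "g w = g z" "g w \<noteq> g a" "g w \<noteq> g b" and uv: "u \<in> S" "v \<in> S" "g u \<noteq> g w"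
      "merge g a b u = merge g a b v" for w z u v
  proof -
    have "cbetw w a z \<longleftrightarrow> cbetw w b z"
      using wz(3-5) by (intro adjacent_cbetw[OF assms(2) wz(1,2)]) auto
    moreover have "cbetw w p z \<longleftrightarrow> cbetw w q z" if "p \<in> S" "q \<in> S" "g p = g q" "g p \<noteq> g w" for p q
      using noncrossD[OF assms(1), of w z p q] wz that by auto
    ultimately show ?thesis
      using uv wz ab unfolding merge_def by (metis (full_types))
  qed
  show "cbetw w v z"
  proof (cases "g w = g a \<or> g w = g b")
    case False
    then show ?thesis
      using side[of w z u v] S eq uz by (auto simp: merge_def split: if_splits)
  next
    \<comment> \<open>A chord of the merged block. Separation of two pairs is symmetric, so
      \<open>side\<close> is applied to the chord from \<open>u\<close> to \<open>v\<close>
      instead.\<close>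
    case True
    then have "g u \<noteq> g a" "g u \<noteq> g b" "g u = g v" "g w \<noteq> g u" "g z \<noteq> g u"
      using eq by (auto simp: merge_def split: if_splits)
    then have "cbetw u w v \<longleftrightarrow> cbetw u z v"
      using side[of u v w z] S eq by simp
    moreover have "w \<noteq> u" "w \<noteq> v" "z \<noteq> u" "z \<noteq> v"
      using \<open>g w \<noteq> g u\<close> \<open>g z \<noteq> g u\<close> \<open>g u = g v\<close> by auto
    ultimately show ?thesis
      using uz by (auto simp: cbetw_def split: if_splits)
  qed
qed

text \<open>The cycle of the block of \<open>b\<close> is spliced into that of the block of
  \<open>a\<close> just behind \<open>a\<close>, and \<open>b\<close> is dropped: \<open>a\<close>
  continues as \<open>b\<close> did, and a point that led to \<open>b\<close> now leads to
  \<open>t\<close>, the old successor of \<open>a\<close>. If \<open>b\<close> is alone in its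
  block, \<open>a\<close> keeps \<open>t\<close>.\<close>

lemma bnext_merge:
  assumes fin: "finite S" and nc: "noncross S g" and adj: "adjacent S a b" and ne: "g a \<noteq> g b"
    and x: "x \<in> S - {b}"
  defines "t \<equiv> bnext S g a" and "y \<equiv> bnext S g (if x = a then b else x)"
  shows "bnext (S - {b}) (merge g a b) x = (if y = b then t else y)"
proof -
  have ab: "a \<in> S" "b \<in> S" "a < b" and gap: "\<And>z. z \<in> S \<Longrightarrow> z \<le> a \<or> b \<le> z"
    using adj unfolding adjacent_def by force+
  have t: "t \<in> S" "g t = g a" "\<And>z. z \<in> S \<Longrightarrow> g z = g a \<Longrightarrow> \<not> cbetw a z t"
    using bnext_props[OF fin ab(1), where f = g] unfolding t_def by auto
  have "t \<noteq> b"
    using t(2) ne by auto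
  have x': "(if x = a then b else x) \<in> S"
    using x ab by auto
  have y: "y \<in> S" "g y = g (if x = a then b else x)"
    "\<And>z. z \<in> S \<Longrightarrow> g z = g (if x = a then b else x) \<Longrightarrow> \<not> cbetw (if x = a then b else x) z y"
    using bnext_props[OF fin x', where f = g] unfolding y_def by auto
  define m where "m = (if y = b then t else y)"
  have "m \<in> S - {b}" "merge g a b m = merge g a b x"
    using t(1,2) y(1,2) \<open>t \<noteq> b\<close> ne unfolding m_def merge_def by (auto split: if_splits)
  moreover have "\<not> cbetw x z m" if z: "z \<in> S" "z \<noteq> b" "merge g a b z = merge g a b x" for z
  proof
    assume xzm: "cbetw x z m"
    consider (out) "g x \<noteq> g a" "g x \<noteq> g b" | (a) "x = a" | (K) "x \<noteq> a" "g x = g a" | (L) "x \<noteq> a" "g x = g b"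
      by blast
    then show False
    proof cases
      case out
      then have "x \<noteq> a" "y \<noteq> b" "g z = g x"
        using y(2) z(3) by (auto simp: merge_def split: if_splits)
      then show False
        using y(3) z xzm by (auto simp: m_def)
    next
      case a
      then have gz: "g z = g a \<or> g z = g b"
        using z(3) by (auto simp: merge_def split: if_splits)
      show False
      proof (cases "y = b")
        case True
        then have "\<not> cbetw b z b" if "g z = g b"
          using y(3) z a that by auto
        then have "g z = g a"
          using gz z(2) by (auto simp: cbetw_def)
        then show False
          using t(3) z xzm True a by (auto simp: m_def)
      next
        case False
        then have azy: "cbetw a z y" "y \<noteq> a"
          using xzm a y(2) ne by (auto simp: m_def)
        \<comment> \<open>\<open>b\<close> is the first point after \<open>a\<close>, so the arc may
          start at \<open>b\<close>. By non-crossing, a \<open>z\<close> in the block of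
          \<open>a\<close> would put \<open>a\<close> itself on the arc from \<open>b\<close> to
          \<open>y\<close>; but \<open>a\<close> is the last point reached from
          \<open>b\<close>.\<close>
        then have bzy: "cbetw b z y"
          using gap[OF z(1)] gap[OF y(1)] z(2) False ab(3) by (auto simp: cbetw_def split: if_splits)
        then have "g z = g a"
          using y(3) z gz a by auto
        then have "cbetw b a y"
          using noncrossD[OF nc, of b y z a] ab z y a ne bzy by auto
        then show False
          using gap[OF y(1)] azy False ab(3) gap[OF z(1)] z(2) by (auto simp: cbetw_def split: if_splits)
      qed
    next
      case K
      \<comment> \<open>The arc from \<open>x\<close> to \<open>y\<close> avoids \<open>a\<close>,
        hence also its neighbour \<open>b\<close>; by non-crossing it avoids the whole block of
        \<open>b\<close>.\<close>
      have nyb: "y \<noteq> b" "m = y"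
        using K y(2) ne by (auto simp: m_def)
      have "x \<noteq> b"
        using x by simp
      have "\<not> cbetw x a y"
        using y(3) ab K by simp
      moreover have "y \<noteq> x"
        using K(1) \<open>\<not> cbetw x a y\<close> by (auto simp: cbetw_def)
      ultimately have "\<not> cbetw x b y"
        using gap[of x] gap[OF y(1)] x K nyb \<open>x \<noteq> b\<close> ab(3) by (auto simp: cbetw_def split: if_splits)
      moreover have "g z = g b"
        using z(3) K y(3)[OF z(1)] xzm nyb by (auto simp: merge_def split: if_splits)
      ultimately show False
        using noncrossD[OF nc, of x y z b] x y z ab K ne xzm nyb by auto
    next
      case L
      have "x \<noteq> b"
        using x by simp
      have xby: "\<not> cbetw x b y"
        using y(3) ab L by simp
      have gz: "g z = g a \<or> g z = g b"
        using z(3) L by (auto simp: merge_def split: if_splits)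
      have "y \<noteq> x"
        using xby \<open>x \<noteq> b\<close> by (auto simp: cbetw_def)
      have "y \<noteq> a"
        using y(2) L ne by auto
      show False
      proof (cases "y = b")
        case False
        then have "\<not> cbetw x a y"
          using gap[of x] gap[OF y(1)] x L \<open>x \<noteq> b\<close> ab(3) xby \<open>y \<noteq> x\<close> \<open>y \<noteq> a\<close>
          by (auto simp: cbetw_def split: if_splits)
        moreover have "g z = g a"
          using gz L y(3)[OF z(1)] xzm False by (auto simp: m_def)
        ultimately show False
          using noncrossD[OF nc, of x y z a] x y z ab L ne xzm False by (auto simp: m_def)
      next
        case True
        \<comment> \<open>Here \<open>x\<close> precedes \<open>b\<close> in its block. The arc from
          \<open>a\<close> to \<open>t\<close> contains \<open>b\<close>, right behind
          \<open>a\<close>, hence by non-crossing also \<open>x\<close>; so the arc from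
          \<open>x\<close> to \<open>t\<close> avoids \<open>a\<close>.\<close>
        have xt: "x \<noteq> t"
          using t(2) L ne by auto
        have side: "cbetw a b t \<longleftrightarrow> cbetw a x t"
          using noncrossD[OF nc, of a t b x] ab t x L ne by auto
        have xat: "\<not> cbetw x a t"
          using side gap[of x] gap[OF t(1)] x L xt \<open>t \<noteq> b\<close> ab(3) \<open>x \<noteq> b\<close>
          by (auto simp: cbetw_def split: if_splits)
        have xzt: "cbetw x z t"
          using xzm True by (simp add: m_def)
        have "z \<noteq> a" "z \<noteq> x"
          using xat xzt xt by (auto simp: cbetw_def split: if_splits)
        from gz show False
        proof
          assume "g z = g a"
          then have "\<not> cbetw a z t"
            using t z by simp
          then show False
            using xat xzt \<open>z \<noteq> a\<close> xt L(1) by (auto simp: cbetw_def split: if_splits)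
        next
          assume gzb: "g z = g b"
          then have "\<not> cbetw x z b"
            using y(3)[OF z(1)] L True by simp
          then have xbt: "cbetw x b t"
            using xzt z(2) \<open>z \<noteq> x\<close> \<open>x \<noteq> b\<close> \<open>t \<noteq> b\<close> by (auto simp: cbetw_def split: if_splits)
          then have "t \<noteq> a"
            using gap[of x] x L(1) \<open>x \<noteq> b\<close> ab(3) by (auto simp: cbetw_def split: if_splits)
          then show False
            using adjacent_cbetw[OF adj, of x t] x t(1) L(1) \<open>x \<noteq> b\<close> \<open>t \<noteq> b\<close> xbt xat by blast
        qed
      qed
    qed
  qed
  ultimately have "bnext (S - {b}) (merge g a b) x = m"
    using fin x by (subst bnext_iff) auto
  then show ?thesis
    by (simp add: m_def)
qed

section \<open>The genus zero formula\<close>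

text \<open>Every odd point \<open>2x + 1\<close> of the matchings joins the two even points \<open>2y\<close>, \<open>2z\<close> with \<open>(y, z)\<close> in this relation,
  so its components are the circles.\<close>
definition circ_rel :: "nat set \<Rightarrow> (nat \<Rightarrow> 'a) \<Rightarrow> (nat \<Rightarrow> 'b) \<Rightarrow> (nat \<times> nat) set" where
  "circ_rel S f g = (\<lambda>x. (bnext S f x, bnext S g x)) ` S"

definition join_rel :: "nat set \<Rightarrow> (nat \<Rightarrow> 'a) \<Rightarrow> (nat \<Rightarrow> 'b) \<Rightarrow> (nat \<times> nat) set" where
  "join_rel S f g = {(x, y). x \<in> S \<and> y \<in> S \<and> (f x = f y \<or> g x = g y)}"

lemma circ_rel_split:
  "d \<in> S \<Longrightarrow> circ_rel S f g
     = insert (bnext S f d, bnext S g d) ((\<lambda>x. (bnext S f x, bnext S g x)) ` (S - {d}))"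
  unfolding circ_rel_def by blast

lemma circ_rel_subset: "finite S \<Longrightarrow> circ_rel S f g \<subseteq> S \<times> S"
  by (auto simp: circ_rel_def bnext_props)

lemma join_rel_subset: "join_rel S f g \<subseteq> S \<times> S"
  by (auto simp: join_rel_def)

text \<open>Such a point is a circle and a joined block by itself. Deleting it lowers both sides of
  the genus formula by three.\<close>

lemma genus_zero_step_isolated:
  assumes "finite S" "a \<in> S"
    and fa: "\<forall>x\<in>S. f x = f a \<longrightarrow> x = a" and ga: "\<forall>x\<in>S. g x = g a \<longrightarrow> x = a"
  shows "ncomp S (circ_rel S f g) = Suc (ncomp (S - {a}) (circ_rel (S - {a}) f g))"
    and "ncomp S (join_rel S f g) = Suc (ncomp (S - {a}) (join_rel (S - {a}) f g))"
proof -
  have S: "S = insert a (S - {a})"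
    using assms(2) by blast
  have na: "bnext S f a = a" "bnext S g a = a"
    using bnext_props(1,2)[OF assms(1,2)] fa ga by metis+
  have nx: "bnext (S - {a}) f x = bnext S f x" "bnext (S - {a}) g x = bnext S g x" if "x \<in> S - {a}" for x
    using bnext_delete[OF assms(1,2) that] na by metis+
  have "circ_rel S f g = insert (bnext S f a, bnext S g a) ((\<lambda>x. (bnext S f x, bnext S g x)) ` (S - {a}))"
    using assms(2) by (rule circ_rel_split)
  also have "\<dots> = insert (a, a) (circ_rel (S - {a}) f g)"
    unfolding circ_rel_def na using nx by (intro arg_cong[of _ _ "insert _"] image_cong) auto
  finally have circ: "circ_rel S f g = insert (a, a) (circ_rel (S - {a}) f g)" .
  show "ncomp S (circ_rel S f g) = Suc (ncomp (S - {a}) (circ_rel (S - {a}) f g))"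
    unfolding circ using ncomp_isolated[of "S - {a}" a] assms(1) circ_rel_subset[of "S - {a}" f g] S by simp
  have "x = a \<longleftrightarrow> y = a" if "x \<in> S" "y \<in> S" "f x = f y \<or> g x = g y" for x y
    using that fa ga by metis
  then have join: "join_rel S f g = insert (a, a) (join_rel (S - {a}) f g)"
    unfolding join_rel_def using assms(2) by blast
  show "ncomp S (join_rel S f g) = Suc (ncomp (S - {a}) (join_rel (S - {a}) f g))"
    unfolding join using ncomp_isolated[of "S - {a}" a] assms(1) join_rel_subset[of "S - {a}" f g] S by simp
qed

text \<open>The edge of the circle relation indexed by \<open>d\<close> is \<open>(c, t)\<close>,
  and \<open>c\<close> is collapsed onto \<open>t\<close>. The remaining edges are indexed by
  \<open>S - {d}\<close>, those of the new relation by \<open>S - {c}\<close>, and \<open>k\<close>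
  translates. Used with \<open>c = d\<close> for a singleton block of \<open>f\<close>, and with
  \<open>d = a\<close>, \<open>c = b\<close> for adjacent points.\<close>

lemma ncomp_circ_contract:
  assumes "finite S" "c \<in> S" "d \<in> S" "t \<in> S - {c}"
    and "bnext S f d = c" "bnext S g d = t"
    and k: "bij_betw k (S - {c}) (S - {d})"
    and f': "\<And>x. x \<in> S - {c} \<Longrightarrow> bnext (S - {c}) f' x = bnext S f (k x)"
    and g': "\<And>x. x \<in> S - {c} \<Longrightarrow> bnext (S - {c}) g' x = (if bnext S g (k x) = c then t else bnext S g (k x))"
  shows "ncomp S (circ_rel S f g) = ncomp (S - {c}) (circ_rel (S - {c}) f' g')"
proof -
  let ?h = "\<lambda>y. if y = c then t else y"
  define X where "X = (\<lambda>x. (bnext S f x, bnext S g x)) ` (S - {d})"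
  have S: "insert c (S - {c}) = S"
    using assms(2) by auto
  have circ: "circ_rel S f g = insert (c, t) X"
    unfolding X_def using circ_rel_split[OF assms(3), of f g] assms(5,6) by simp
  have kim: "k ` (S - {c}) = S - {d}"
    using k by (rule bij_betw_imp_surj_on)
  have ne: "bnext S f x \<noteq> c" if "x \<in> S - {d}" for x
    using bnext_inj[OF assms(1), of x d f] that assms(3,5) by auto
  have "map_prod ?h ?h ` X = (\<lambda>x. (?h (bnext S f (k x)), ?h (bnext S g (k x)))) ` (S - {c})"
    unfolding X_def kim[symmetric] image_image by simp
  also have "\<dots> = circ_rel (S - {c}) f' g'"
    unfolding circ_rel_def
  proof (rule image_cong[OF refl])
    fix x assume x: "x \<in> S - {c}"
    then have "bnext S f (k x) \<noteq> c"
      using ne kim by blast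
    then show "(?h (bnext S f (k x)), ?h (bnext S g (k x))) = (bnext (S - {c}) f' x, bnext (S - {c}) g' x)"
      using f'[OF x] g'[OF x] by simp
  qed
  finally have "map_prod ?h ?h ` X = circ_rel (S - {c}) f' g'" .
  moreover have "X \<subseteq> insert c (S - {c}) \<times> insert c (S - {c})"
    unfolding S X_def using assms(1) by (auto simp: bnext_props)
  ultimately show ?thesis
    unfolding circ using ncomp_contract[of c "S - {c}" t X] assms(4) S by simp
qed

text \<open>The new labels may be coarser than the old ones, as after a merge, but only by
  identifications that the join makes already.\<close>

lemma ncomp_join_contract:
  assumes "a \<in> S" "b \<in> S" "a \<noteq> b"
    and edge: "(a, b) \<in> join_rel S f g"
    and fwd: "\<And>x. x \<in> S - {b} \<Longrightarrow> f x = f b \<Longrightarrow> f' x = f' a" "\<And>x. x \<in> S - {b} \<Longrightarrow> g x = g b \<Longrightarrow> g' x = g' a"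
      "\<And>x y. f x = f y \<Longrightarrow> f' x = f' y" "\<And>x y. g x = g y \<Longrightarrow> g' x = g' y"
    and bwd: "\<And>x y. x \<in> S \<Longrightarrow> y \<in> S \<Longrightarrow> f' x = f' y \<or> g' x = g' y \<Longrightarrow> (x, y) \<in> conn (join_rel S f g)"
  shows "ncomp S (join_rel S f g) = ncomp (S - {b}) (join_rel (S - {b}) f' g')"
proof (rule ncomp_quotient[where h = "\<lambda>x. if x = b then a else x"])
  let ?h = "\<lambda>x. if x = b then a else x"
  have ab: "(a, b) \<in> conn (join_rel S f g)"
    using edge by (rule conn_edge)
  show "?h ` S = S - {b}"
    using assms(1-3) by (auto simp: image_iff)
  show "join_rel (S - {b}) f' g' \<subseteq> (S - {b}) \<times> (S - {b})"
    by (rule join_rel_subset)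
  show "(?h x, ?h y) \<in> conn (join_rel (S - {b}) f' g')" if "(x, y) \<in> join_rel S f g" for x y
  proof (rule conn_edge)
    show "(?h x, ?h y) \<in> join_rel (S - {b}) f' g'"
      using that assms(1-3) fwd(1)[of x] fwd(2)[of x] fwd(1)[of y] fwd(2)[of y] fwd(3)[of x y] fwd(4)[of x y]
      unfolding join_rel_def by auto
  qed
  show "\<exists>x\<in>S. \<exists>y\<in>S. ?h x = u \<and> ?h y = v \<and> (x, y) \<in> conn (join_rel S f g)"
    if "(u, v) \<in> join_rel (S - {b}) f' g'" for u v
    using that bwd[of u v] by (intro bexI[of _ u] bexI[of _ v]) (auto simp: join_rel_def)
  show "(x, y) \<in> conn (join_rel S f g)" if "?h x = ?h y" for x y
    using that ab conn_sym[OF ab] by (auto split: if_splits)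
qed

lemma card_image_remove_isolated:
  assumes "finite S" "a \<in> S" "\<And>x. x \<in> S \<Longrightarrow> f x = f a \<Longrightarrow> x = a"
  shows "card (f ` S) = Suc (card (f ` (S - {a})))"
proof -
  have "f ` S = insert (f a) (f ` (S - {a}))"
    using assms(2) by blast
  moreover have "f a \<notin> f ` (S - {a})"
  proof
    assume "f a \<in> f ` (S - {a})"
    then obtain x where "x \<in> S - {a}" "f x = f a" by (metis imageE)
    then show False using assms(3) by blast
  qed
  ultimately show ?thesis
    using assms(1) by simp
qed

lemma image_remove_redundant:
  assumes "a \<in> S" "a \<noteq> b" "f a = f b"
  shows "f ` (S - {b}) = f ` S"
proof
  show "f ` S \<subseteq> f ` (S - {b})"
  proof
    fix u assume "u \<in> f ` S"
    then obtain x where "x \<in> S" "u = f x"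
      by blast
    then show "u \<in> f ` (S - {b})"
      using assms by (metis Diff_iff imageI singletonD)
  qed
qed blast

lemma bnext_delete_succ:
  assumes "finite S" "a \<in> S" "b \<in> S" "bnext S f a = b" "x \<in> S - {b}"
  shows "bnext (S - {b}) f x = bnext S f (if x = a then b else x)"
proof (cases "x = a")
  case True
  then show ?thesis
    using bnext_delete[OF assms(1,3,5), of f] assms(4) by simp
next
  case False
  then have "bnext S f x \<noteq> b"
    using bnext_inj[of S x a f] assms by auto
  then show ?thesis
    using bnext_delete[OF assms(1,3,5), of f] False by simp
qed

lemma card_image_merge:
  assumes "finite S" "a \<in> S" "b \<in> S" "g a \<noteq> g b"
  shows "card (g ` S) = Suc (card (merge g a b ` (S - {b})))"
proof -
  have "merge g a b ` (S - {b}) = g ` S - {g b}"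
    using assms(2-4) by (auto simp: merge_def image_iff)
  then show ?thesis
    using assms(1,3) card_Suc_Diff1[of "g ` S" "g b"] by simp
qed

text \<open>Losses of (circles, blocks of \<open>f\<close>, blocks of \<open>g\<close>, joined
  blocks) when one point goes: (1,1,1,1) for a point alone in both partitions, (0,1,0,0) if alone
  only in \<open>f\<close>, (1,0,0,0) for adjacent points sharing both blocks, (0,0,1,0) if they
  share only that of \<open>f\<close>. Each balances the formula.\<close>

theorem genus_zero:
  fixes f :: "nat \<Rightarrow> 'a" and g :: "nat \<Rightarrow> 'b"
  assumes "finite S" "noncross S f" "noncross S g"
  shows "ncomp S (circ_rel S f g) + card (f ` S) + card (g ` S) = card S + 2 * ncomp S (join_rel S f g)"
  using assms
\<comment> \<open>\<open>f\<close> is only ever restricted, while \<open>g\<close> may be merged;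
  hence \<open>g\<close> is generalized.\<close>
proof (induction "card S" arbitrary: S g)
  case 0
  then show ?case by (simp add: ncomp_def)
next
  case (Suc n)
  note fin = Suc.prems(1) and ncf = Suc.prems(2) and ncg = Suc.prems(3)
  have IH: "ncomp (S - {c}) (circ_rel (S - {c}) f g') + card (f ` (S - {c})) + card (g' ` (S - {c}))
     = n + 2 * ncomp (S - {c}) (join_rel (S - {c}) f g')"
    if "c \<in> S" "noncross (S - {c}) g'" for c and g' :: "nat \<Rightarrow> 'b"
  proof -
    have "n = card (S - {c})"
      using Suc.hyps(2) that(1) by simp
    then show ?thesis
      using Suc.hyps(1)[of "S - {c}" g'] fin that(2) noncross_subset[OF ncf] by auto
  qed
  have ncg': "noncross (S - {c}) g" for c
    using ncg by (rule noncross_subset) blast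
  have "S \<noteq> {}"
    using Suc.hyps(2) by auto
  from fin this ncf show ?case
  proof (rule noncross_reducible)
    fix a
    assume a: "a \<in> S" and fa: "\<And>x. x \<in> S \<Longrightarrow> f x = f a \<Longrightarrow> x = a"
    have cf: "card (f ` S) = Suc (card (f ` (S - {a})))"
      using fin a fa by (rule card_image_remove_isolated)
    show ?case
    proof (cases "\<forall>x\<in>S. g x = g a \<longrightarrow> x = a")
      case True
      then have "card (g ` S) = Suc (card (g ` (S - {a})))"
        using fin a by (intro card_image_remove_isolated) auto
      moreover have "ncomp S (circ_rel S f g) = Suc (ncomp (S - {a}) (circ_rel (S - {a}) f g))"
        "ncomp S (join_rel S f g) = Suc (ncomp (S - {a}) (join_rel (S - {a}) f g))"
        using genus_zero_step_isolated[OF fin a, of f g] fa True by blast+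
      ultimately show ?thesis
        using IH[OF a ncg'] cf Suc.hyps(2) by simp
    next
      case False
      then obtain s where s: "s \<in> S" "g s = g a" "s \<noteq> a"
        by blast
      define t where "t = bnext S g a"
      have t: "t \<in> S" "g t = g a" "\<not> cbetw a s t"
        using bnext_props[OF fin a, where f = g] s by (auto simp: t_def)
      have ta: "t \<noteq> a"
        using t(3) s(3) by (auto simp: cbetw_def)
      have na: "bnext S f a = a"
        using bnext_props(1,2)[OF fin a, where f = f] fa by metis
      \<comment> \<open>\<open>a\<close> is its own successor under \<open>f\<close>, so its edge is
        \<open>(a, t)\<close>, and the circle is shortened by collapsing \<open>a\<close> onto
        \<open>t\<close>.\<close>
      have "ncomp S (circ_rel S f g) = ncomp (S - {a}) (circ_rel (S - {a}) f g)"
      proof (rule ncomp_circ_contract[OF fin a a, where t = t and k = id])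
        fix x assume x: "x \<in> S - {a}"
        show "bnext (S - {a}) f x = bnext S f (id x)"
          using bnext_delete[OF fin a x, of f] na by simp
        show "bnext (S - {a}) g x = (if bnext S g (id x) = a then t else bnext S g (id x))"
          using bnext_delete[OF fin a x, of g] by (simp add: t_def)
      qed (use t ta na t_def in auto)
      moreover have "ncomp S (join_rel S f g) = ncomp (S - {a}) (join_rel (S - {a}) f g)"
      proof (rule ncomp_join_contract[OF t(1) a ta])
        fix x assume "x \<in> S - {a}" "f x = f a"
        then show "f x = f t"
          using fa by blast
      qed (use t a in \<open>auto simp: join_rel_def intro!: conn_edge\<close>)
      moreover have "card (g ` (S - {a})) = card (g ` S)"
        using image_remove_redundant[OF t(1) ta t(2)] by simp
      ultimately show ?thesis
        using IH[OF a ncg'] cf Suc.hyps(2) by simp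
    qed
  next
    fix a b
    assume adj: "adjacent S a b" and fab: "f a = f b"
    then have ab: "a \<in> S" "b \<in> S" "a \<noteq> b" "a \<in> S - {b}"
      by (auto simp: adjacent_def)
    have cf: "card (f ` (S - {b})) = card (f ` S)"
      using image_remove_redundant[of a S b f] ab fab by simp
    have fnext: "bnext S f a = b"
      using bnext_adjacent fin adj fab by blast
    show ?case
    proof (cases "g a = g b")
      case True
      then have gnext: "bnext S g a = b"
        using bnext_adjacent fin adj by blast
      let ?k = "\<lambda>x. if x = a then b else x"
      have im: "?k ` (S - {b}) = S - {a}"
        using ab by auto
      have S: "insert b (S - {b}) = S"
        using ab by auto
      \<comment> \<open>Both partitions lead from \<open>a\<close> to \<open>b\<close>: the two arcs
        across the gap close up to a circle of their own, the loop \<open>(b, b)\<close>.\<close>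
      have "circ_rel S f g = insert (b, b) ((\<lambda>x. (bnext S f x, bnext S g x)) ` (S - {a}))"
        using circ_rel_split[OF ab(1), of f g] fnext gnext by simp
      also have "\<dots> = insert (b, b) ((\<lambda>x. (bnext S f (?k x), bnext S g (?k x))) ` (S - {b}))"
        unfolding im[symmetric] image_image ..
      also have "\<dots> = insert (b, b) (circ_rel (S - {b}) f g)"
        unfolding circ_rel_def using bnext_delete_succ[OF fin ab(1,2) fnext] bnext_delete_succ[OF fin ab(1,2) gnext]
        by (intro arg_cong[of _ _ "insert _"] image_cong) auto
      finally have circ: "circ_rel S f g = insert (b, b) (circ_rel (S - {b}) f g)" .
      have "ncomp S (circ_rel S f g) = Suc (ncomp (S - {b}) (circ_rel (S - {b}) f g))"
        unfolding circ using ncomp_isolated[of "S - {b}" b] fin circ_rel_subset[of "S - {b}" f g] S by simp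
      moreover have "ncomp S (join_rel S f g) = ncomp (S - {b}) (join_rel (S - {b}) f g)"
        by (rule ncomp_join_contract[OF ab(1-3)])
          (use ab fab True in \<open>auto simp: join_rel_def intro!: conn_edge\<close>)
      moreover have "card (g ` (S - {b})) = card (g ` S)"
        using image_remove_redundant[of a S b g] ab True by simp
      ultimately show ?thesis
        using IH[OF ab(2) ncg'] cf Suc.hyps(2) by simp
    next
      case False
      define g' where "g' = merge g a b"
      have "noncross (S - {b}) g'"
        unfolding g'_def using noncross_merge[OF ncg adj False] by (rule noncross_subset) blast
      note IH' = IH[OF ab(2) this]
      let ?k = "\<lambda>x. if x = a then b else x"
      have "ncomp S (circ_rel S f g) = ncomp (S - {b}) (circ_rel (S - {b}) f g')"
      proof (rule ncomp_circ_contract[OF fin ab(2) ab(1), where t = "bnext S g a" and k = ?k])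
        show "bnext S g a \<in> S - {b}"
          using bnext_props(1,2)[OF fin ab(1), where f = g] False by auto
        show "bij_betw ?k (S - {b}) (S - {a})"
          using ab by (auto simp: bij_betw_def inj_on_def)
        fix x assume x: "x \<in> S - {b}"
        show "bnext (S - {b}) f x = bnext S f (?k x)"
          using fin ab(1,2) fnext x by (rule bnext_delete_succ)
        show "bnext (S - {b}) g' x = (if bnext S g (?k x) = b then bnext S g a else bnext S g (?k x))"
          unfolding g'_def using fin ncg adj False x by (rule bnext_merge)
      qed (use fnext in auto)
      moreover have "ncomp S (join_rel S f g) = ncomp (S - {b}) (join_rel (S - {b}) f g')"
      proof (rule ncomp_join_contract[OF ab(1-3)])
        fix x y assume xy: "x \<in> S" "y \<in> S" "f x = f y \<or> g' x = g' y"
        have e: "(u, v) \<in> conn (join_rel S f g)" if "u \<in> S" "v \<in> S" "f u = f v \<or> g u = g v" for u v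
          using that by (auto simp: join_rel_def intro!: conn_edge)
        from xy consider "f x = f y \<or> g x = g y" | "g x = g a" "g y = g b" | "g x = g b" "g y = g a"
          unfolding g'_def merge_def by metis
        then show "(x, y) \<in> conn (join_rel S f g)"
        proof cases
          case 1
          then show ?thesis using e xy by blast
        next
          case 2
          then have "(x, a) \<in> conn (join_rel S f g)" "(a, b) \<in> conn (join_rel S f g)" "(b, y) \<in> conn (join_rel S f g)"
            using e xy ab fab by auto
          then show ?thesis by (blast intro: conn_trans)
        next
          case 3
          then have "(x, b) \<in> conn (join_rel S f g)" "(b, a) \<in> conn (join_rel S f g)" "(a, y) \<in> conn (join_rel S f g)"
            using e xy ab fab by auto
          then show ?thesis by (blast intro: conn_trans)
        qed
      qed (use ab fab in \<open>auto simp: join_rel_def g'_def merge_def\<close>)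
      moreover have "card (g ` S) = Suc (card (g' ` (S - {b})))"
        unfolding g'_def using fin ab(1,2) False by (rule card_image_merge)
      ultimately show ?thesis
        using IH' cf Suc.hyps(2) by simp
    qed
  qed
qed

section \<open>Quotients by an involution\<close>

text \<open>A fixed element counts once in \<open>X\<close> and once among the orbits, so the
  difference consists of the two-element orbits alone. This cancels zero blocks and zero circles,
  however many there are.\<close>

lemma involution_count:
  assumes "finite X" "\<And>K. K \<in> X \<Longrightarrow> r K \<in> X" "\<And>K. K \<in> X \<Longrightarrow> r (r K) = K"
  shows "card X = card ((\<lambda>K. {K, r K}) ` X) + card {K \<in> X. r K \<noteq> K} div 2"
proof -
  let ?Z = "{K \<in> X. r K = K}" and ?N = "{K \<in> X. r K \<noteq> K}" and ?\<phi> = "\<lambda>K. {K, r K}"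
  have fin: "finite ?Z" "finite ?N"
    using assms(1) by auto
  have X: "X = ?Z \<union> ?N"
    by blast
  have "card X = card ?Z + card ?N"
    using fin by (subst X, intro card_Un_disjoint) auto
  moreover have "card (?\<phi> ` X) = card (?\<phi> ` ?Z) + card (?\<phi> ` ?N)"
  proof -
    have "?\<phi> ` ?Z \<inter> ?\<phi> ` ?N = {}"
      by (auto simp: doubleton_eq_iff)
    then have "card (?\<phi> ` ?Z \<union> ?\<phi> ` ?N) = card (?\<phi> ` ?Z) + card (?\<phi> ` ?N)"
      using fin by (intro card_Un_disjoint) auto
    then show ?thesis
      by (metis X image_Un)
  qed
  moreover have "card (?\<phi> ` ?Z) = card ?Z"
    by (intro card_image inj_onI) auto
  moreover have "2 * card (?\<phi> ` ?N) = card (\<Union> (?\<phi> ` ?N))"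
  proof (rule card_partition)
    show "c1 \<inter> c2 = {}" if c: "c1 \<in> ?\<phi> ` ?N" "c2 \<in> ?\<phi> ` ?N" "c1 \<noteq> c2" for c1 c2
    proof -
      obtain K L where KL: "K \<in> X" "L \<in> X" "c1 = {K, r K}" "c2 = {L, r L}"
        using c(1,2) by blast
      then have "r (r K) = K" "r (r L) = L"
        using assms(3) by auto
      then show ?thesis
        using c(3) KL(3,4) by (auto simp: doubleton_eq_iff)
    qed
  qed (use fin in auto)
  moreover have "\<Union> (?\<phi> ` ?N) = ?N"
    using assms(2,3) by force
  ultimately show ?thesis
    by simp
qed

lemma conn_invariant:
  assumes "(x, y) \<in> conn E" "\<And>u v. (u, v) \<in> E \<Longrightarrow> l u = l v"
  shows "l x = l y"
  using assms(1) unfolding conn_def by (induction rule: rtrancl_induct) (use assms(2) in auto)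

text \<open>\<open>D\<close> glues each point to its image, so the components of
  \<open>E \<union> D\<close> are the orbits of the components of \<open>E\<close>. They are
  labelled by the unordered pair of the classes of \<open>x\<close> and
  \<open>\<rho> x\<close>.\<close>

lemma ncomp_involution:
  assumes fin: "finite S" and sub: "E \<subseteq> S \<times> S"
    and \<rho>: "\<And>x. x \<in> S \<Longrightarrow> \<rho> x \<in> S" "\<And>x. x \<in> S \<Longrightarrow> \<rho> (\<rho> x) = x"
    and inv: "\<And>x y. (x, y) \<in> E \<Longrightarrow> (\<rho> x, \<rho> y) \<in> E"
    and D: "\<And>x y. (x, y) \<in> D \<Longrightarrow> x \<in> S \<and> (y = x \<or> y = \<rho> x)" "\<And>x. x \<in> S \<Longrightarrow> (x, \<rho> x) \<in> D"
  shows "ncomp S E = ncomp S (E \<union> D) + card {C \<in> (\<lambda>x. conn E `` {x}) ` S. \<rho> ` C \<noteq> C} div 2"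
proof -
  define cls where "cls = (\<lambda>x. conn E `` {x})"
  have cls_eq: "cls x = cls y \<longleftrightarrow> (x, y) \<in> conn E" for x y
    unfolding cls_def by (rule conn_class_eq)
  have map: "(\<rho> x, \<rho> y) \<in> conn E" if "(x, y) \<in> conn E" for x y
    using that by (rule conn_map) (use inv in \<open>auto intro: conn_edge\<close>)
  have img: "\<rho> ` cls x = cls (\<rho> x)" if x: "x \<in> S" for x
  proof
    show "\<rho> ` cls x \<subseteq> cls (\<rho> x)"
      using map unfolding cls_def by auto
    show "cls (\<rho> x) \<subseteq> \<rho> ` cls x"
    proof
      fix y assume "y \<in> cls (\<rho> x)"
      then have y: "(\<rho> x, y) \<in> conn E"
        by (simp add: cls_def)
      then have "y \<in> S"
        using conn_closed[OF _ _ sub] \<rho>(1) x by blast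
      moreover have "\<rho> y \<in> cls x"
        using map[OF y] \<rho>(2)[OF x] by (simp add: cls_def)
      ultimately show "y \<in> \<rho> ` cls x"
        using \<rho>(2) by (metis imageI)
    qed
  qed
  have "card (cls ` S) = card ((\<lambda>K. {K, \<rho> ` K}) ` cls ` S) + card {C \<in> cls ` S. \<rho> ` C \<noteq> C} div 2"
  proof (rule involution_count)
    fix K assume "K \<in> cls ` S"
    then obtain x where x: "x \<in> S" "K = cls x"
      by blast
    show "\<rho> ` K \<in> cls ` S" "\<rho> ` \<rho> ` K = K"
      using x img \<rho> by simp_all
  qed (use fin in simp)
  moreover have "(\<lambda>K. {K, \<rho> ` K}) ` cls ` S = (\<lambda>x. {cls x, cls (\<rho> x)}) ` S"
    unfolding image_image using img by (intro image_cong) auto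
  moreover have "ncomp S (E \<union> D) = card ((\<lambda>x. {cls x, cls (\<rho> x)}) ` S)"
  proof (rule ncomp_label)
    fix x y assume xy: "x \<in> S" "y \<in> S"
    show "{cls x, cls (\<rho> x)} = {cls y, cls (\<rho> y)} \<longleftrightarrow> (x, y) \<in> conn (E \<union> D)"
    proof
      assume "(x, y) \<in> conn (E \<union> D)"
      then show "{cls x, cls (\<rho> x)} = {cls y, cls (\<rho> y)}"
      proof (rule conn_invariant)
        fix u v assume "(u, v) \<in> E \<union> D"
        then show "{cls u, cls (\<rho> u)} = {cls v, cls (\<rho> v)}"
        proof
          assume "(u, v) \<in> E"
          then have "cls u = cls v" "cls (\<rho> u) = cls (\<rho> v)"
            unfolding cls_eq using inv by (auto intro: conn_edge)
          then show ?thesis by simp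
        next
          assume "(u, v) \<in> D"
          then show ?thesis
            using D(1)[of u v] \<rho>(2)[of u] by (auto simp: insert_commute)
        qed
      qed
    next
      assume "{cls x, cls (\<rho> x)} = {cls y, cls (\<rho> y)}"
      then have "(x, y) \<in> conn E \<or> (x, \<rho> y) \<in> conn E"
        unfolding cls_eq[symmetric] by (auto simp: doubleton_eq_iff)
      moreover have "(\<rho> y, y) \<in> conn (E \<union> D)"
        by (rule conn_sym[OF conn_edge]) (use D(2)[OF xy(2)] in simp)
      ultimately show "(x, y) \<in> conn (E \<union> D)"
        using conn_mono[of E "E \<union> D", OF Un_upper1] conn_trans[of x "\<rho> y" "E \<union> D" y] by blast
    qed
  qed
  ultimately show ?thesis
    unfolding ncomp_def cls_def by simp
qed

text \<open>For the unreduced count of circles, where congruent matching points are already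
  equal.\<close>

lemma ncomp_Un_Id:
  assumes "D \<subseteq> Id"
  shows "ncomp S (E \<union> D) = ncomp S E"
proof -
  have "(x, y) \<in> conn (E \<union> D)" if "(x, y) \<in> conn E" for x y
    using conn_mono[of E "E \<union> D", OF _ that] by simp
  moreover have "(x, y) \<in> conn E" if "(x, y) \<in> conn (E \<union> D)" for x y
  proof -
    have "(id x, id y) \<in> conn E"
      using that by (rule conn_map) (use assms in \<open>auto intro: conn_edge\<close>)
    then show ?thesis by simp
  qed
  ultimately have "(x, y) \<in> conn (E \<union> D) \<longleftrightarrow> (x, y) \<in> conn E" for x y
    by blast
  then show ?thesis
    unfolding ncomp_def Image_def by simp
qed

section \<open>Type B partitions\<close>

text \<open>Turns a partition into a labelling of its points, the form required by
  \<open>genus_zero\<close>.\<close>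

definition blk :: "'a set set \<Rightarrow> 'a \<Rightarrow> 'a set" where
  "blk P x = (THE K. K \<in> P \<and> x \<in> K)"

lemma blk_eqI:
  assumes "partition_on A P" "K \<in> P" "x \<in> K"
  shows "blk P x = K"
  unfolding blk_def
proof (rule the_equality)
  show "L = K" if "L \<in> P \<and> x \<in> L" for L
    using that assms partition_onD2[OF assms(1)] by (auto simp: disjoint_def)
qed (use assms in simp)

lemma blk_mem:
  assumes "partition_on A P" "x \<in> A"
  shows "blk P x \<in> P" "x \<in> blk P x"
proof -
  obtain K where "K \<in> P" "x \<in> K"
    using assms partition_onD1 by blast
  then show "blk P x \<in> P" "x \<in> blk P x"
    using blk_eqI[OF assms(1)] by auto
qed

lemma blk_eq_iff:
  assumes "partition_on A P" "x \<in> A" "y \<in> A"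
  shows "blk P x = blk P y \<longleftrightarrow> y \<in> blk P x"
  using blk_mem[OF assms(1,2)] blk_mem[OF assms(1,3)] blk_eqI[OF assms(1)] by metis

lemma blk_image:
  assumes "partition_on A P"
  shows "blk P ` A = P"
proof
  show "blk P ` A \<subseteq> P"
    using blk_mem[OF assms] by auto
  show "P \<subseteq> blk P ` A"
  proof
    fix K assume K: "K \<in> P"
    then obtain x where "x \<in> K"
      using partition_onD3[OF assms] by fastforce
    moreover have "x \<in> A"
      using partition_onD1[OF assms] K \<open>x \<in> K\<close> by blast
    ultimately show "K \<in> blk P ` A"
      using blk_eqI[OF assms K] by blast
  qed
qed

lemma finite_greatest_below:
  fixes K :: "'a :: linorder set"
  assumes "finite K" "a \<in> K" "a < b"
  shows "\<exists>i\<in>K. i < b \<and> (\<forall>x\<in>K. x < b \<longrightarrow> x \<le> i)"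
proof -
  have "Max {k \<in> K. k < b} \<in> {k \<in> K. k < b}"
    using assms by (intro Max_in) auto
  moreover have "x \<le> Max {k \<in> K. k < b}" if "x \<in> K" "x < b" for x
    using assms(1) that by (intro Max_ge) auto
  ultimately show ?thesis
    by blast
qed

lemma finite_least_above:
  fixes K :: "'a :: linorder set"
  assumes "finite K" "a \<in> K" "b < a"
  shows "\<exists>i\<in>K. b < i \<and> (\<forall>x\<in>K. b < x \<longrightarrow> i \<le> x)"
proof -
  have "Min {k \<in> K. b < k} \<in> {k \<in> K. b < k}"
    using assms by (intro Min_in) auto
  moreover have "Min {k \<in> K. b < k} \<le> x" if "x \<in> K" "b < x" for x
    using assms(1) that by (intro Min_le) auto
  ultimately show ?thesis
    by blast
qed

text \<open>\<open>noncrossing\<close> speaks only of chords, which join consecutive elements. Given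
  an interleaving \<open>a < b < c < d\<close>, take the chord \<open>(i, j)\<close> of
  \<open>K\<close> that spans \<open>b\<close>, then the chord \<open>(k, l)\<close> of
  \<open>L\<close> that spans \<open>j\<close>; since \<open>i < b \<le> k\<close>, they
  cross.\<close>

lemma noncross_blk:
  assumes part: "partition_on A P" and fin: "finite A" and nc: "noncrossing P"
  shows "noncross A (blk P)"
proof (rule noncrossI)
  fix a b c d
  assume A: "a \<in> A" "b \<in> A" "c \<in> A" "d \<in> A" and less: "a < b" "b < c" "c < d"
    and eq: "blk P a = blk P c" "blk P b = blk P d"
  show "blk P a = blk P b"
  proof (rule ccontr)
    assume ne: "blk P a \<noteq> blk P b"
    define K L where "K = blk P a" and "L = blk P b"
    have KL: "K \<in> P" "L \<in> P" "a \<in> K" "c \<in> K" "b \<in> L" "d \<in> L" "K \<inter> L = {}"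
      using blk_mem[OF part] A eq ne partition_onD2[OF part] unfolding K_def L_def
      by (auto simp: disjoint_def)
    have "K \<subseteq> A" "L \<subseteq> A"
      using partition_onD1[OF part] KL by auto
    then have finKL: "finite K" "finite L"
      using fin finite_subset by auto
    obtain i where i: "i \<in> K" "i < b" "\<And>x. x \<in> K \<Longrightarrow> x < b \<Longrightarrow> x \<le> i"
      using finite_greatest_below[OF finKL(1) KL(3) less(1)] by blast
    obtain j where j: "j \<in> K" "b < j" "\<And>x. x \<in> K \<Longrightarrow> b < x \<Longrightarrow> j \<le> x"
      using finite_least_above[OF finKL(1) KL(4) less(2)] by blast
    obtain k where k: "k \<in> L" "k < j" "\<And>x. x \<in> L \<Longrightarrow> x < j \<Longrightarrow> x \<le> k"
      using finite_greatest_below[OF finKL(2) KL(5) j(2)] by blast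
    have "j < d"
      using j(3)[OF KL(4) less(2)] less(3) by simp
    then obtain l where l: "l \<in> L" "j < l" "\<And>x. x \<in> L \<Longrightarrow> j < x \<Longrightarrow> l \<le> x"
      using finite_least_above[OF finKL(2) KL(6)] by blast
    have "\<not> (\<exists>x\<in>K. i < x \<and> x < j)"
      using i j KL by (metis disjoint_iff leD linorder_neqE_nat)
    then have "(i, j) \<in> chords P"
      using i j KL unfolding chords_def by auto
    moreover have "\<not> (\<exists>x\<in>L. k < x \<and> x < l)"
      using k l j KL by (metis disjoint_iff leD linorder_neqE_nat)
    then have "(k, l) \<in> chords P"
      using k l KL unfolding chords_def by auto
    moreover have "i < k"
      using k(3)[of b] KL j(2) i(2) by simp
    ultimately show False
      using nc k l unfolding noncrossing_def by blast
  qed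
qed

section \<open>Negation of positions and reduction modulo \<open>n\<close>\<close>

lemma mod_less_double:
  fixes x m :: nat
  assumes "x < 2 * m"
  shows "x mod m = (if x < m then x else x - m)"
  using assms le_mod_geq[of m x] by auto

lemma negB_eq:
  assumes "x < 2 * n"
  shows "negB n x = (if x < n then x + n else x - n)"
  using assms mod_less_double[of "x + n" "2 * n"] by (auto simp: negB_def)

lemma negB_lt: "x < 2 * n \<Longrightarrow> negB n x < 2 * n"
  by (auto simp: negB_eq)

lemma negB_negB: "x < 2 * n \<Longrightarrow> negB n (negB n x) = x"
  by (auto simp: negB_eq)

lemma negB_mod: "x < 2 * n \<Longrightarrow> negB n x mod n = x mod n"
  by (auto simp: negB_eq mod_less_double)

lemma mod_eq_negB:
  assumes "x < 2 * n" "y < 2 * n" "x mod n = y mod n"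
  shows "y = x \<or> y = negB n x"
  using assms by (auto simp: negB_eq mod_less_double split: if_splits)

lemma cbetw_negB:
  assumes "x < 2 * n" "y < 2 * n" "z < 2 * n"
  shows "cbetw (negB n x) (negB n z) (negB n y) \<longleftrightarrow> cbetw x z y"
  using assms by (auto simp: negB_eq cbetw_def)

section \<open>Type B partitions modulo negation\<close>

abbreviation nextB :: "nat \<Rightarrow> nat set set \<Rightarrow> nat \<Rightarrow> nat" where
  "nextB n P \<equiv> bnext {0..<2 * n} (blk P)"

text \<open>A block of the quotient is an orbit \<open>{K, -K}\<close>, with one element if
  \<open>K\<close> is a zero block. Restricted to \<open>{0..<n}\<close>, this labels the quotient
  circle, one point for each antipodal pair.\<close>

definition qblk :: "nat \<Rightarrow> nat set set \<Rightarrow> nat \<Rightarrow> nat set set" where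
  "qblk n P x = {blk P x, negsetB n (blk P x)}"

context
  fixes n :: nat and P :: "nat set set"
  assumes n: "n \<ge> 1" and P: "P \<in> NCB n"
begin

lemma NCB_partition: "partition_on {0..<2 * n} P" and NCB_neg: "K \<in> P \<Longrightarrow> negsetB n K \<in> P"
  and NCB_noncrossing: "noncrossing P"
  using P by (auto simp: NCB_def typeB_partition_def)

lemma NCB_noncross: "noncross {0..<2 * n} (blk P)"
  by (rule noncross_blk[OF NCB_partition _ NCB_noncrossing]) simp

lemma negsetB_negsetB: "K \<in> P \<Longrightarrow> negsetB n (negsetB n K) = K"
proof -
  assume "K \<in> P"
  then have "x < 2 * n" if "x \<in> K" for x
    using NCB_partition that partition_onD1 by fastforce
  then show ?thesis
    unfolding negsetB_def image_image by (simp add: negB_negB)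
qed

lemma blk_negB:
  assumes "x < 2 * n"
  shows "blk P (negB n x) = negsetB n (blk P x)"
proof (rule blk_eqI[OF NCB_partition])
  show "negsetB n (blk P x) \<in> P" "negB n x \<in> negsetB n (blk P x)"
    using blk_mem[OF NCB_partition, of x] NCB_neg assms by (auto simp: negsetB_def)
qed

lemma blk_negB_eq_iff:
  assumes "x < 2 * n" "y < 2 * n"
  shows "blk P (negB n x) = blk P y \<longleftrightarrow> blk P x = blk P (negB n y)"
  using assms blk_negB negB_lt negB_negB by metis

lemma qblk_eq_iff:
  assumes "x < 2 * n" "y < 2 * n"
  shows "qblk n P x = qblk n P y \<longleftrightarrow> blk P x = blk P y \<or> blk P x = blk P (negB n y)"
proof -
  have "qblk n P z = {blk P z, blk P (negB n z)}" if "z < 2 * n" for z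
    using blk_negB[OF that] by (simp add: qblk_def)
  then show ?thesis
    using assms blk_negB_eq_iff[OF assms] blk_negB[OF assms(1)] blk_negB[OF assms(2)] by (auto simp: doubleton_eq_iff)
qed

lemma qblk_negB:
  assumes "x < 2 * n"
  shows "qblk n P (negB n x) = qblk n P x"
  using qblk_eq_iff[OF negB_lt[OF assms] assms] by simp

lemma qblk_mod:
  assumes "x < 2 * n"
  shows "qblk n P (x mod n) = qblk n P x"
proof -
  define y where "y = x mod n"
  have "y < 2 * n" "y mod n = x mod n"
    using assms mod_less_eq_dividend[of x n] unfolding y_def by (linarith, simp)
  then have "qblk n P y = qblk n P x"
    using mod_eq_negB[of y n x] assms qblk_negB[of y] by metis
  then show ?thesis
    by (simp add: y_def)
qed

lemma qblk_image: "qblk n P ` {0..<n} = (\<lambda>K. {K, negsetB n K}) ` P"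
proof -
  have "qblk n P ` {0..<n} = qblk n P ` {0..<2 * n}"
  proof
    show "qblk n P ` {0..<2 * n} \<subseteq> qblk n P ` {0..<n}"
    proof
      fix u assume "u \<in> qblk n P ` {0..<2 * n}"
      then obtain x where "x < 2 * n" "u = qblk n P x"
        by auto
      then have "u = qblk n P (x mod n)" "x mod n \<in> {0..<n}"
        using qblk_mod n by auto
      then show "u \<in> qblk n P ` {0..<n}"
        by (rule image_eqI)
    qed
  qed auto
  also have "\<dots> = (\<lambda>K. {K, negsetB n K}) ` blk P ` {0..<2 * n}"
    unfolding image_image qblk_def ..
  finally show ?thesis
    using blk_image[OF NCB_partition] by simp
qed

lemma card_NCB: "card P = card (qblk n P ` {0..<n}) + nzbk n P"
proof -
  have "finite P"
    using NCB_partition finite_elements by blast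
  then show ?thesis
    unfolding qblk_image nzbk_def using NCB_neg negsetB_negsetB by (intro involution_count)
qed

text \<open>Equal quotient labels lift to equal blocks after shifting one end by \<open>n\<close> if
  necessary. In each of the four lifts, two pairs interleave on the large circle.\<close>

lemma noncross_qblk: "noncross {0..<n} (qblk n P)"
proof (rule noncrossI)
  fix a b c d
  assume S: "a \<in> {0..<n}" "b \<in> {0..<n}" "c \<in> {0..<n}" "d \<in> {0..<n}" and less: "a < b" "b < c" "c < d"
    and eq: "qblk n P a = qblk n P c" "qblk n P b = qblk n P d"
  have q: "qblk n P x = qblk n P y \<longleftrightarrow> blk P x = blk P y \<or> blk P x = blk P (y + n)" if "x < n" "y < n" for x y
    using qblk_eq_iff[of x y] that by (simp add: negB_eq)
  have nc: "blk P p = blk P q" if "p < q" "q < r" "r < s" "s < 2 * n" "blk P p = blk P r" "blk P q = blk P s" for p q r s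
    using noncrossD[OF NCB_noncross, of p r q s] that by (auto simp: cbetw_def)
  \<comment> \<open>In the third case the pair \<open>c\<close>, \<open>a + n\<close> interleaves
    with \<open>b\<close>, \<open>d\<close>, which yields the block of \<open>c\<close> in place of
    that of \<open>a\<close>; their quotient labels agree.\<close>
  have "blk P a = blk P b \<or> blk P b = blk P c"
  proof -
    consider "blk P a = blk P c" "blk P b = blk P d" | "blk P a = blk P c" "blk P b = blk P (d + n)"
      | "blk P a = blk P (c + n)" "blk P b = blk P d"
      | "blk P a = blk P (c + n)" "blk P b = blk P (d + n)"
      using eq q S by auto
    then show ?thesis
    proof cases
      case 1 then show ?thesis using nc[of a b c d] less S by auto
    next
      case 2 then show ?thesis using nc[of a b c "d + n"] less S by auto
    next
      case 3
      then have "blk P c = blk P (a + n)"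
        using blk_negB_eq_iff[of a c] S by (auto simp: negB_eq)
      then show ?thesis using nc[of b c d "a + n"] 3 less S by auto
    next
      case 4 then show ?thesis using nc[of a b "c + n" "d + n"] less S by auto
    qed
  qed
  then show "qblk n P a = qblk n P b"
  proof
    assume "blk P b = blk P c"
    then have "qblk n P b = qblk n P c"
      by (simp add: qblk_def)
    then show ?thesis
      using eq(1) by simp
  qed (simp add: qblk_def)
qed

lemma bnext_props_pts:
  assumes "x < 2 * n"
  shows "nextB n P x < 2 * n" "blk P (nextB n P x) = blk P x"
    "\<And>z. z < 2 * n \<Longrightarrow> blk P z = blk P x \<Longrightarrow> \<not> cbetw x z (nextB n P x)"
  using bnext_props[of "{0..<2 * n}" x, where f = "blk P"] assms by auto

lemma bnext_negB:
  assumes x: "x < 2 * n"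
  shows "nextB n P (negB n x) = negB n (nextB n P x)"
proof -
  note y = bnext_props_pts[OF x]
  have "\<not> cbetw (negB n x) z (negB n (nextB n P x))" if z: "z < 2 * n" "blk P z = blk P (negB n x)" for z
  proof -
    have "blk P (negB n z) = blk P x"
      using blk_negB_eq_iff[OF z(1) x] z(2) by simp
    then have "\<not> cbetw x (negB n z) (nextB n P x)"
      using y(3) negB_lt z(1) by blast
    then show ?thesis
      using cbetw_negB[OF x y(1) negB_lt[OF z(1)]] negB_negB[OF z(1)] by simp
  qed
  then show ?thesis
    using negB_lt x y blk_negB by (subst bnext_iff) auto
qed

text \<open>Makes the arcs of \<open>betaB\<close> descend to the quotient. An intermediate quotient
  point \<open>z\<close> has a lift \<open>w\<close> in the block of \<open>x\<close>, which cannot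
  lie between \<open>x\<close> and its successor \<open>y\<close>; the other lift remains to be
  excluded.\<close>

lemma bnext_qblk:
  assumes x: "x < 2 * n"
  shows "bnext {0..<n} (qblk n P) (x mod n) = nextB n P x mod n"
proof -
  define y where "y = nextB n P x"
  note y = bnext_props_pts[OF x, folded y_def]
  have "\<not> cbetw (x mod n) z (y mod n)" if z: "z < n" "qblk n P z = qblk n P (x mod n)" for z
  proof
    assume between: "cbetw (x mod n) z (y mod n)"
    have "blk P z = blk P x \<or> blk P (negB n z) = blk P x"
      using z qblk_eq_iff[of z x] qblk_mod[OF x] x blk_negB_eq_iff[of z x] by auto
    then obtain w where w: "w = z \<or> w = negB n z" "blk P w = blk P x"
      by blast
    have w': "w < 2 * n" "negB n w < 2 * n" "w mod n = z"
      using w(1) z(1) negB_lt[of z n] negB_lt[of w n] negB_mod[of z n] by auto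
    have between': "cbetw (x mod n) (w mod n) (y mod n)"
      using between w'(3) by simp
    have nw: "\<not> cbetw x w y"
      using y(3) w' w by blast
    \<comment> \<open>An arc of more than half a turn would contain both lifts of \<open>z\<close>,
      in particular \<open>w\<close>. A shorter arc, or one of exactly half a turn
      (\<open>y = negB n x\<close>), contains one lift, which must be
      \<open>negB n w\<close>.\<close>
    have "cbetw x (negB n w) y \<and> \<not> cbetw x (negB n x) y \<and> y \<noteq> negB n x \<or> cbetw x (negB n w) y \<and> y = negB n x"
      using between' nw x y(1) w'(1)
      by (auto simp: cbetw_def negB_eq mod_less_double split: if_splits)
    \<comment> \<open>In a zero block, \<open>negB n w\<close> would come before the successor
      \<open>y\<close>. Otherwise it shares a different block with \<open>negB n x\<close>, and the
      chord from \<open>x\<close> to \<open>y\<close> would separate these two.\<close>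
    moreover have False if "blk P (negB n x) = blk P x" "cbetw x (negB n w) y"
      using y(3)[of "negB n w"] that w' w(2) blk_negB_eq_iff[of w x] x by auto
    moreover have "cbetw x (negB n w) y \<longleftrightarrow> cbetw x (negB n x) y" if "blk P (negB n x) \<noteq> blk P x"
      using noncrossD[OF NCB_noncross, of x y "negB n w" "negB n x"] that w' w(2) x y blk_negB[of w] blk_negB[of x]
        negB_lt[OF x] by auto
    ultimately show False
      using y(2) by blast
  qed
  moreover have "y mod n < n" "x mod n < n"
    using n by auto
  moreover have "qblk n P (y mod n) = qblk n P (x mod n)"
    using qblk_mod[OF x] qblk_mod[OF y(1)] y(2) by (simp add: qblk_def)
  ultimately show ?thesis
    unfolding y_def[symmetric] by (subst bnext_iff) auto
qed

lemma betaB_eq: "betaB P = (\<lambda>x. {2 * x + 1, 2 * nextB n P x}) ` {0..<2 * n}"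
proof -
  have next_eq: "nextB n P x = cyc_succ (blk P x) x" if "x \<in> {0..<2 * n}" for x
  proof -
    have sub: "blk P x \<subseteq> {0..<2 * n}"
      using blk_mem[OF NCB_partition that] partition_onD1[OF NCB_partition] by blast
    have "y \<in> blk P x \<longleftrightarrow> y \<in> {0..<2 * n} \<and> blk P x = blk P y" for y
      using subsetD[OF sub, of y] blk_eq_iff[OF NCB_partition that, of y] by argo
    then have "{y \<in> {0..<2 * n}. blk P y = blk P x} = blk P x"
      by (intro set_eqI) (simp only: mem_Collect_eq eq_commute[of "blk P x"])
    then show ?thesis
      by (simp add: bnext_def)
  qed
  show ?thesis
  proof
    show "betaB P \<subseteq> (\<lambda>x. {2 * x + 1, 2 * nextB n P x}) ` {0..<2 * n}"
    proof
      fix e assume "e \<in> betaB P"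
      then obtain K a where Ka: "K \<in> P" "a \<in> K" "e = {2 * a + 1, 2 * cyc_succ K a}"
        unfolding betaB_def by blast
      then have a: "a \<in> {0..<2 * n}" "blk P a = K"
        using partition_onD1[OF NCB_partition] blk_eqI[OF NCB_partition] by auto
      then have "e = {2 * a + 1, 2 * nextB n P a}"
        using next_eq[OF a(1)] Ka(3) by simp
      then show "e \<in> (\<lambda>x. {2 * x + 1, 2 * nextB n P x}) ` {0..<2 * n}"
        using a(1) by (rule image_eqI)
    qed
    show "(\<lambda>x. {2 * x + 1, 2 * nextB n P x}) ` {0..<2 * n} \<subseteq> betaB P"
    proof (rule image_subsetI)
      fix x assume x: "x \<in> {0..<2 * n}"
      show "{2 * x + 1, 2 * nextB n P x} \<in> betaB P"
        unfolding betaB_def using next_eq[OF x] blk_mem[OF NCB_partition x]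
        by (intro CollectI exI[of _ "blk P x"] exI[of _ x]) simp
    qed
  qed
qed

end

section \<open>Circles and joins\<close>

definition matching_rel :: "nat set set \<Rightarrow> nat set set \<Rightarrow> (nat \<times> nat) set" where
  "matching_rel M M' = {(x, y). {x, y} \<in> M \<union> M'}"

lemma conn_symmetric:
  assumes "E\<inverse> = E"
  shows "conn E = E\<^sup>*"
  using assms by (simp add: conn_def)

lemma circles_eq: "circles n M M' = (\<lambda>x. conn (matching_rel M M') `` {x}) ` {0..<4 * n}"
proof -
  have "(matching_rel M M')\<inverse> = matching_rel M M'"
    by (auto simp: matching_rel_def insert_commute)
  from conn_symmetric[OF this] show ?thesis
    by (auto simp: circles_def quotient_def matching_rel_def)
qed

lemma matching_rel_edge:
  assumes "n \<ge> 1" "P \<in> NCB n" "Q \<in> NCB n" "x < 2 * n"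
  shows "(2 * x + 1, 2 * nextB n P x) \<in> matching_rel (betaB P) (betaB Q)"
    "(2 * x + 1, 2 * nextB n Q x) \<in> matching_rel (betaB P) (betaB Q)"
  unfolding matching_rel_def betaB_eq[OF assms(1,2)] betaB_eq[OF assms(1,3)]
  using imageI[of x "{0..<2 * n}" "\<lambda>x. {2 * x + 1, 2 * nextB n P x}"]
    imageI[of x "{0..<2 * n}" "\<lambda>x. {2 * x + 1, 2 * nextB n Q x}"] assms(4) by simp_all

lemma matching_rel_cases:
  assumes "n \<ge> 1" "P \<in> NCB n" "Q \<in> NCB n" "(u, v) \<in> matching_rel (betaB P) (betaB Q)"
  obtains x R where "x < 2 * n" "R = P \<or> R = Q" "{u, v} = {2 * x + 1, 2 * nextB n R x}"
proof -
  have "{u, v} \<in> (\<lambda>x. {2 * x + 1, 2 * nextB n P x}) ` {0..<2 * n}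
      \<or> {u, v} \<in> (\<lambda>x. {2 * x + 1, 2 * nextB n Q x}) ` {0..<2 * n}"
    using assms(4) unfolding matching_rel_def betaB_eq[OF assms(1,2)] betaB_eq[OF assms(1,3)] by simp
  then show thesis
  proof (elim disjE imageE)
    fix x assume "{u, v} = {2 * x + 1, 2 * nextB n P x}" "x \<in> {0..<2 * n}"
    then show thesis using that[of x P] by simp
  next
    fix x assume "{u, v} = {2 * x + 1, 2 * nextB n Q x}" "x \<in> {0..<2 * n}"
    then show thesis using that[of x Q] by simp
  qed
qed

text \<open>Applied with \<open>m = 2 * n\<close>, where \<open>D\<close> is trivial, and with
  \<open>m = n\<close>, where \<open>D\<close> glues antipodal points; \<open>F\<close> and
  \<open>G\<close> are the labellings by blocks and by quotient blocks, respectively.\<close>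

lemma ncomp_circles:
  fixes F :: "nat \<Rightarrow> 'a" and G :: "nat \<Rightarrow> 'b"
  assumes n: "n \<ge> 1" and P: "P \<in> NCB n" and Q: "Q \<in> NCB n" and m: "0 < m" "m \<le> 2 * n"
    and F: "\<And>x. x < 2 * n \<Longrightarrow> bnext {0..<m} F (x mod m) = nextB n P x mod m"
    and G: "\<And>x. x < 2 * n \<Longrightarrow> bnext {0..<m} G (x mod m) = nextB n Q x mod m"
  defines "D \<equiv> {(u, v). u < 4 * n \<and> v < 4 * n \<and> u mod (2 * m) = v mod (2 * m)}"
  shows "ncomp {0..<4 * n} (matching_rel (betaB P) (betaB Q) \<union> D) = ncomp {0..<m} (circ_rel {0..<m} F G)"
proof (rule ncomp_quotient)
  \<comment> \<open>\<open>h\<close> contracts the arcs of \<open>betaB P\<close>: an odd point goes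
    where its even partner goes. An arc of \<open>betaB Q\<close> then becomes the edge of
    \<open>circ_rel\<close> indexed by its odd end.\<close>
  define h where "h u = (if even u then (u div 2) mod m else nextB n P (u div 2) mod m)" for u
  \<comment> \<open>An even point in the component of \<open>u\<close>. Equal values of
    \<open>h\<close> make these representatives congruent modulo \<open>2 * m\<close>, hence related
    by \<open>D\<close>.\<close>
  define e where "e u = (if even u then u else 2 * nextB n P (u div 2))" for u
  let ?E = "matching_rel (betaB P) (betaB Q)"
  let ?C = "circ_rel {0..<m} F G"
  note edge = matching_rel_edge[OF n P Q]
  have Eq: "u mod (2 * m) = 2 * (u div 2 mod m) + u mod 2" for u
    by (rule mod_mult2_eq)
  have h_odd: "h (2 * x + 1) = nextB n P x mod m" and h_even: "h (2 * x) = x mod m" for x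
    by (simp_all add: h_def)
  show "h ` {0..<4 * n} = {0..<m}"
  proof
    show "h ` {0..<4 * n} \<subseteq> {0..<m}"
      using m(1) by (auto simp: h_def)
    show "{0..<m} \<subseteq> h ` {0..<4 * n}"
    proof
      fix y assume "y \<in> {0..<m}"
      then have "y = h (2 * y)" "2 * y \<in> {0..<4 * n}"
        using m by (auto simp: h_even)
      then show "y \<in> h ` {0..<4 * n}"
        by (rule image_eqI)
    qed
  qed
  show "?C \<subseteq> {0..<m} \<times> {0..<m}"
    by (rule circ_rel_subset) simp
  show "(h u, h v) \<in> conn ?C" if "(u, v) \<in> ?E \<union> D" for u v
    using that
  proof
    assume "(u, v) \<in> ?E"
    then obtain x R where x: "x < 2 * n" "R = P \<or> R = Q" "{u, v} = {2 * x + 1, 2 * nextB n R x}"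
      using matching_rel_cases[OF n P Q] by metis
    have "(nextB n P x mod m, nextB n Q x mod m) \<in> ?C"
      unfolding circ_rel_def F[OF x(1), symmetric] G[OF x(1), symmetric] using m(1) by (intro imageI) simp
    then have "(h (2 * x + 1), h (2 * nextB n R x)) \<in> conn ?C"
      unfolding h_odd h_even using x(2) by (auto intro: conn_edge)
    moreover from this have "(h (2 * nextB n R x), h (2 * x + 1)) \<in> conn ?C"
      by (rule conn_sym)
    moreover have "u = 2 * x + 1 \<and> v = 2 * nextB n R x \<or> u = 2 * nextB n R x \<and> v = 2 * x + 1"
      using x(3) by (simp only: doubleton_eq_iff)
    ultimately show ?thesis
      by (elim disjE) simp_all
  next
    assume "(u, v) \<in> D"
    then have uv: "u < 4 * n" "v < 4 * n" "2 * (u div 2 mod m) + u mod 2 = 2 * (v div 2 mod m) + v mod 2"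
      unfolding D_def Eq by auto
    have "u mod 2 = v mod 2 \<and> a = b" if "2 * a + u mod 2 = 2 * b + v mod 2" for a b
      using that by presburger
    then have par: "u mod 2 = v mod 2" and eq: "u div 2 mod m = v div 2 mod m"
      using uv(3) by blast+
    \<comment> \<open>At an odd point, too, \<open>h\<close> depends only on the position modulo
      \<open>m\<close>, because successors commute with the reduction.\<close>
    have "h w = (if even w then w div 2 mod m else bnext {0..<m} F (w div 2 mod m))" if "w < 4 * n" for w
      unfolding h_def using F[of "w div 2"] that by simp
    then have "h u = h v"
      using uv(1,2) par eq by (simp add: even_iff_mod_2_eq_zero)
    then show ?thesis
      by simp
  qed
  show "\<exists>x\<in>{0..<4 * n}. \<exists>y\<in>{0..<4 * n}. h x = u \<and> h y = v \<and> (x, y) \<in> conn (?E \<union> D)"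
    if uv: "(u, v) \<in> ?C" for u v
  proof -
    obtain x where x: "x < m" "u = bnext {0..<m} F x" "v = bnext {0..<m} G x"
      using uv unfolding circ_rel_def by auto
    have x': "x < 2 * n"
      using x(1) m(2) by simp
    have "h (2 * x + 1) = u" "h (2 * nextB n Q x) = v"
      unfolding h_odd h_even using x F[OF x'] G[OF x'] by auto
    moreover have "(2 * x + 1, 2 * nextB n Q x) \<in> conn (?E \<union> D)"
      using edge(2)[OF x'] by (intro conn_edge) simp
    moreover have "2 * x + 1 \<in> {0..<4 * n}" "2 * nextB n Q x \<in> {0..<4 * n}"
      using x' bnext_props_pts(1)[OF n Q x'] by auto
    ultimately show ?thesis
      by blast
  qed
  have e: "(u, e u) \<in> conn (?E \<union> D)" "even (e u)" "e u < 4 * n" "h u = e u div 2 mod m" if u: "u < 4 * n" for u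
  proof -
    have "(u, e u) \<in> conn (?E \<union> D) \<and> e u < 4 * n"
    proof (cases "even u")
      case False
      then obtain x where x: "u = 2 * x + 1"
        by (rule oddE)
      then have "x < 2 * n"
        using u by simp
      then show ?thesis
        using x edge(1)[of x] bnext_props_pts(1)[OF n P, of x] by (auto simp: e_def intro!: conn_edge)
    qed (use u in \<open>simp add: e_def\<close>)
    then show "(u, e u) \<in> conn (?E \<union> D)" "e u < 4 * n"
      by auto
    show "even (e u)" "h u = e u div 2 mod m"
      by (auto simp: e_def h_def)
  qed
  show "(u, v) \<in> conn (?E \<union> D)" if uv: "u \<in> {0..<4 * n}" "v \<in> {0..<4 * n}" "h u = h v" for u v
  proof -
    have u: "u < 4 * n" and v: "v < 4 * n"
      using uv by auto
    have "e u mod (2 * m) = e v mod (2 * m)"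
      unfolding Eq using e(2,4)[OF u] e(2,4)[OF v] uv(3) by (simp add: even_iff_mod_2_eq_zero)
    then have "(e u, e v) \<in> conn (?E \<union> D)"
      using e(3)[OF u] e(3)[OF v] by (intro conn_edge) (simp add: D_def)
    then show ?thesis
      using e(1)[OF u] conn_sym[OF e(1)[OF v]] conn_trans by metis
  qed
qed

text \<open>The matching points carry the same antipodal map with \<open>2 * n\<close> for
  \<open>n\<close>, so the arithmetic of \<open>negB\<close> applies to them.\<close>

lemma rotM_eq: "rotM n x = negB (2 * n) x"
  by (simp add: rotM_def negB_def)

lemma rotM_double:
  assumes "x < 2 * n"
  shows "rotM n (2 * x) = 2 * negB n x" "rotM n (2 * x + 1) = 2 * negB n x + 1"
  using assms by (auto simp: rotM_eq negB_eq)

lemma card_circles: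
  assumes n: "n \<ge> 1" and P: "P \<in> NCB n" and Q: "Q \<in> NCB n"
  shows "ncomp {0..<2 * n} (circ_rel {0..<2 * n} (blk P) (blk Q))
    = ncomp {0..<n} (circ_rel {0..<n} (qblk n P) (qblk n Q)) + cd n (betaB P) (betaB Q)"
proof -
  let ?E = "matching_rel (betaB P) (betaB Q)"
  let ?D = "\<lambda>m. {(u, v). u < 4 * n \<and> v < 4 * n \<and> u mod (2 * m) = v mod (2 * m)}"
  have pt: "nextB n R x < 2 * n" if "R = P \<or> R = Q" "x < 2 * n" for R x
    using that bnext_props_pts(1)[OF n] P Q by blast
  have "ncomp {0..<4 * n} ?E = ncomp {0..<4 * n} (?E \<union> ?D (2 * n))"
    by (subst ncomp_Un_Id) auto
  also have "\<dots> = ncomp {0..<2 * n} (circ_rel {0..<2 * n} (blk P) (blk Q))"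
    using n pt by (intro ncomp_circles[OF n P Q]) auto
  finally have total: "ncomp {0..<4 * n} ?E = ncomp {0..<2 * n} (circ_rel {0..<2 * n} (blk P) (blk Q))" .
  have quot: "ncomp {0..<4 * n} (?E \<union> ?D n) = ncomp {0..<n} (circ_rel {0..<n} (qblk n P) (qblk n Q))"
    using n bnext_qblk[OF n P] bnext_qblk[OF n Q] by (intro ncomp_circles[OF n P Q]) auto
  have "ncomp {0..<4 * n} ?E = ncomp {0..<4 * n} (?E \<union> ?D n)
      + card {C \<in> (\<lambda>x. conn ?E `` {x}) ` {0..<4 * n}. rotM n ` C \<noteq> C} div 2"
  proof (rule ncomp_involution)
    show "?E \<subseteq> {0..<4 * n} \<times> {0..<4 * n}"
    proof clarify
      fix u v assume "(u, v) \<in> ?E"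
      then obtain x R where x: "x < 2 * n" "R = P \<or> R = Q" "{u, v} = {2 * x + 1, 2 * nextB n R x}"
        using matching_rel_cases[OF n P Q] by metis
      then have "{u, v} \<subseteq> {0..<4 * n}"
        using pt by auto
      then show "u \<in> {0..<4 * n} \<and> v \<in> {0..<4 * n}"
        by simp
    qed
    show "(rotM n u, rotM n v) \<in> ?E" if uv: "(u, v) \<in> ?E" for u v
    proof -
      obtain x R where x: "x < 2 * n" "R = P \<or> R = Q" "{u, v} = {2 * x + 1, 2 * nextB n R x}"
        using matching_rel_cases[OF n P Q uv] by metis
      have "rotM n ` {u, v} = {2 * negB n x + 1, 2 * nextB n R (negB n x)}"
        unfolding x(3) using rotM_double x pt bnext_negB[OF n] P Q by auto
      then show ?thesis
        using x(2) negB_lt[OF x(1)] by (auto simp: matching_rel_def betaB_eq[OF n P] betaB_eq[OF n Q])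
    qed
    show "u \<in> {0..<4 * n} \<and> (v = u \<or> v = rotM n u)" if "(u, v) \<in> ?D n" for u v
      using that mod_eq_negB[of u "2 * n" v] by (auto simp: rotM_eq)
  qed (use negB_lt[of _ "2 * n"] negB_negB[of _ "2 * n"] negB_mod[of _ "2 * n"] in \<open>auto simp: rotM_eq\<close>)
  then show ?thesis
    unfolding total quot cd_def circles_eq .
qed

lemma card_join:
  assumes n: "n \<ge> 1" and P: "P \<in> NCB n" and Q: "Q \<in> NCB n"
  shows "ncomp {0..<2 * n} (join_rel {0..<2 * n} (blk P) (blk Q))
    = ncomp {0..<n} (join_rel {0..<n} (qblk n P) (qblk n Q)) + nzbk n (joinB n P Q)"
proof -
  let ?S = "{0..<2 * n}"
  let ?E = "join_rel ?S (blk P) (blk Q)"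
  let ?J = "join_rel {0..<n} (qblk n P) (qblk n Q)"
  define D where "D = {(x, y). x < 2 * n \<and> y < 2 * n \<and> x mod n = y mod n}"
  note part = NCB_partition[OF n P] NCB_partition[OF n Q]
  have rel: "{(x, y). \<exists>K\<in>P \<union> Q. x \<in> K \<and> y \<in> K} = ?E"
  proof -
    have same_block: "(\<exists>K\<in>R. x \<in> K \<and> y \<in> K) \<longleftrightarrow> x \<in> ?S \<and> y \<in> ?S \<and> blk R x = blk R y"
      if R: "partition_on ?S R" for R x y
    proof
      assume "\<exists>K\<in>R. x \<in> K \<and> y \<in> K"
      then obtain K where K: "K \<in> R" "x \<in> K" "y \<in> K"
        by blast
      then show "x \<in> ?S \<and> y \<in> ?S \<and> blk R x = blk R y"
        using partition_onD1[OF R] blk_eqI[OF R K(1)] by blast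
    next
      assume xy: "x \<in> ?S \<and> y \<in> ?S \<and> blk R x = blk R y"
      then show "\<exists>K\<in>R. x \<in> K \<and> y \<in> K"
        using blk_mem[OF R, of x] blk_mem[OF R, of y] by (intro bexI[of _ "blk R x"]) simp_all
    qed
    show ?thesis
      unfolding join_rel_def bex_Un same_block[OF part(1)] same_block[OF part(2)] by blast
  qed
  have conn: "conn ?E = ?E\<^sup>*"
    by (rule conn_symmetric) (auto simp: join_rel_def)
  \<comment> \<open>\<open>joinB\<close> uses the transitive closure, which agrees with the
    reflexive one on the points because \<open>?E\<close> contains their loops.\<close>
  have "?E\<^sup>+ `` {x} = conn ?E `` {x}" if "x \<in> ?S" for x
  proof -
    have "(x, x) \<in> ?E"
      using that by (simp add: join_rel_def)
    then show ?thesis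
      unfolding conn by (auto simp: rtrancl_eq_or_trancl)
  qed
  then have join: "joinB n P Q = (\<lambda>x. conn ?E `` {x}) ` ?S"
    unfolding joinB_def rel quotient_def by auto
  have "ncomp ?S ?E = ncomp ?S (?E \<union> D) + card {C \<in> (\<lambda>x. conn ?E `` {x}) ` ?S. negB n ` C \<noteq> C} div 2"
  proof (rule ncomp_involution)
    show "?E \<subseteq> ?S \<times> ?S"
      by (rule join_rel_subset)
    show "(negB n x, negB n y) \<in> ?E" if "(x, y) \<in> ?E" for x y
      using that negB_lt[of _ n] blk_negB[OF n P] blk_negB[OF n Q] by (auto simp: join_rel_def)
    show "x \<in> ?S \<and> (y = x \<or> y = negB n x)" if "(x, y) \<in> D" for x y
      using that mod_eq_negB[of x n y] by (auto simp: D_def)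
    show "(x, negB n x) \<in> D" if "x \<in> ?S" for x
      using that negB_lt[of x n] negB_mod[of x n] by (simp add: D_def)
  qed (use negB_lt[of _ n] negB_negB[of _ n] in auto)
  moreover have "ncomp ?S (?E \<union> D) = ncomp {0..<n} ?J"
  proof (rule ncomp_quotient[where h = "\<lambda>x. x mod n"])
    show "(\<lambda>x. x mod n) ` ?S = {0..<n}"
    proof
      show "{0..<n} \<subseteq> (\<lambda>x. x mod n) ` ?S"
      proof
        fix y assume "y \<in> {0..<n}"
        then have "y = y mod n" "y \<in> ?S"
          by auto
        then show "y \<in> (\<lambda>x. x mod n) ` ?S"
          by (rule image_eqI)
      qed
    qed (use n in auto)
    show "?J \<subseteq> {0..<n} \<times> {0..<n}"
      by (rule join_rel_subset)
    show "(x mod n, y mod n) \<in> conn ?J" if "(x, y) \<in> ?E \<union> D" for x y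
      using that
    proof
      assume "(x, y) \<in> ?E"
      then have xy: "x < 2 * n" "y < 2 * n" "blk P x = blk P y \<or> blk Q x = blk Q y"
        by (auto simp: join_rel_def)
      then have "qblk n P (x mod n) = qblk n P (y mod n) \<or> qblk n Q (x mod n) = qblk n Q (y mod n)"
        unfolding qblk_mod[OF n P xy(1)] qblk_mod[OF n P xy(2)] qblk_mod[OF n Q xy(1)] qblk_mod[OF n Q xy(2)]
        by (elim disjE) (simp_all add: qblk_def)
      then show ?thesis
        using n by (intro conn_edge) (simp add: join_rel_def)
    qed (simp add: D_def)
    have flip: "(negB n y, y) \<in> conn (?E \<union> D)" if "y < 2 * n" for y
      using that negB_lt[OF that] negB_mod[OF that] by (intro conn_edge) (simp add: D_def)
    show "\<exists>x\<in>?S. \<exists>y\<in>?S. x mod n = u \<and> y mod n = v \<and> (x, y) \<in> conn (?E \<union> D)" if "(u, v) \<in> ?J" for u v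
    proof -
      have uv: "u < n" "v < n" "qblk n P u = qblk n P v \<or> qblk n Q u = qblk n Q v"
        using that by (auto simp: join_rel_def)
      then have lt: "u < 2 * n" "v < 2 * n" "negB n v < 2 * n"
        using negB_lt[of v n] by auto
      \<comment> \<open>Equal orbits of blocks mean that \<open>u\<close> shares a block with
        \<open>v\<close> or with the antipode of \<open>v\<close>, which \<open>D\<close> identifies
        with \<open>v\<close>.\<close>
      have "(u, v) \<in> ?E \<or> (u, negB n v) \<in> ?E"
        using uv(3) lt unfolding qblk_eq_iff[OF n P lt(1,2)] qblk_eq_iff[OF n Q lt(1,2)] join_rel_def
        by (elim disjE) simp_all
      then have "(u, v) \<in> conn (?E \<union> D)"
      proof
        assume "(u, negB n v) \<in> ?E"
        then have "(u, negB n v) \<in> conn (?E \<union> D)"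
          by (intro conn_edge UnI1)
        then show ?thesis
          using flip[OF lt(2)] by (rule conn_trans)
      qed (intro conn_edge UnI1)
      then show ?thesis
        using uv by (intro bexI[of _ u] bexI[of _ v]) auto
    qed
    show "(x, y) \<in> conn (?E \<union> D)" if "x \<in> ?S" "y \<in> ?S" "x mod n = y mod n" for x y
      using that by (intro conn_edge) (simp add: D_def)
  qed
  ultimately show ?thesis
    unfolding nzbk_def negsetB_def join by simp
qed

lemma nzbk_join:
  assumes n: "n \<ge> 1" and P: "P \<in> NCB n" and Q: "Q \<in> NCB n"
  shows "2 * nzbk n (joinB n P Q) + n = cd n (betaB P) (betaB Q) + nzbk n P + nzbk n Q"
proof -
  have "card (blk P ` {0..<2 * n}) = card P" "card (blk Q ` {0..<2 * n}) = card Q"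
    using blk_image NCB_partition[OF n P] NCB_partition[OF n Q] by metis+
  then show ?thesis
    \<comment> \<open>Subtracting the two instances leaves \<open>cd\<close> and the two
      \<open>nzbk\<close> on the left, \<open>n\<close> and twice the \<open>nzbk\<close> of the
      join on the right.\<close>
    using genus_zero[OF _ NCB_noncross[OF n P] NCB_noncross[OF n Q]]
      genus_zero[OF _ noncross_qblk[OF n P] noncross_qblk[OF n Q]]
      card_circles[OF assms] card_join[OF assms] card_NCB[OF n P] card_NCB[OF n Q]
    by simp
qed

theorem theorem2:
  fixes n :: nat and P Q :: "nat set set"
  assumes "n \<ge> 1" and "P \<in> NCB n" and "Q \<in> NCB n"
  shows "(\<forall>\<delta>::real. \<delta> > 0 \<longrightarrow>
            JB_entry n (\<delta>^2) P Q
              = PB_entry n \<delta> P * GB_entry n 1 \<delta> (betaB P) (betaB Q) * PB_entry n \<delta> Q)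
       \<and> 2 * int (nzbk n (joinB n P Q))
           = int (cd n (betaB P) (betaB Q)) + int (nzbk n P) + int (nzbk n Q) - int n"
proof (intro conjI allI impI)
  note count = nzbk_join[OF assms]
  then show "2 * int (nzbk n (joinB n P Q))
      = int (cd n (betaB P) (betaB Q)) + int (nzbk n P) + int (nzbk n Q) - int n"
    by linarith
  fix \<delta> :: real assume \<delta>: "\<delta> > 0"
  \<comment> \<open>The exponents \<open>nzbk - n / 2\<close> may be negative or half-integral,
    hence \<open>powr\<close>. The factor with base 1 disappears, and the two halves add up to
    \<open>n\<close>.\<close>
  have "PB_entry n \<delta> P * GB_entry n 1 \<delta> (betaB P) (betaB Q) * PB_entry n \<delta> Q
      = \<delta> powr (real (nzbk n P) - real n / 2 + real (cd n (betaB P) (betaB Q)) + (real (nzbk n Q) - real n / 2))"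
    unfolding PB_entry_def GB_entry_def powr_add using \<delta> by (simp add: powr_realpow)
  also have "\<dots> = \<delta> powr real (2 * nzbk n (joinB n P Q))"
    using count by (intro arg_cong[of _ _ "\<lambda>x. \<delta> powr x"]) linarith
  also have "\<dots> = JB_entry n (\<delta>^2) P Q"
    using \<delta> by (simp add: JB_entry_def powr_realpow power_mult del: of_nat_mult)
  finally show "JB_entry n (\<delta>^2) P Q
      = PB_entry n \<delta> P * GB_entry n 1 \<delta> (betaB P) (betaB Q) * PB_entry n \<delta> Q" ..
qed

end
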